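(* There exists a joint law for a family of random variables $((U_i, Y_{i\to j}) : i\in\mathcal{B},\ j\in\partial\{i\})$, where the $U_i$, $i \in \mathcal{B}$, are independent and uniformly distributed on $[0,1]$ and each $Y_{i\to j}$ takes values in $I=[1/2,1]\cup\{\infty\}$, which is invariant under automorphisms of the tree $\mathcal{B}$ and such that for each $i\in\mathcal{B}$ and each $j\in\partial\{i\}$: (i) $Y_{j\to i}$ has distribution function $F$; (ii) $Y_{j\to i}=\Phi\big(\min(Y_{i\to k},Y_{i\to l}),\max(Y_{i\to k},Y_{i\to l}),U_i\big)$ almost surely, where $\{k,l\}=\partial\{i\}\setminus\{j\}$; and such that (iii) for each finite connected set $S\subset\mathcal{B}$, the variables $(Y_{i\to j}: i\in S,\ j\notin S,\ j\in\partial\{i\})$ are independent of each other and independent of the collection $(U_i:i\in S)$.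
   Context: $\mathcal{B}$ is the infinite 3-regular tree (Bethe lattice), identified with its set of sites (vertices); for a site $i$, $\partial\{i\}$ denotes the set of its three neighbours. The notation $Y_{i\to j}$ is used only for neighbouring sites $i,j$. Let $I=[1/2,1]\cup\{\infty\}$. The function $\Phi: I\times I\times[0,1]\to I$ is defined by $\Phi(x,y,z)=x$ if $x\ge z$; $\Phi(x,y,z)=y$ if $x<z\le y$; and $\Phi(x,y,z)=\infty$ otherwise. $F$ is the distribution function of an $I$-valued random variable given by $F(t)=0$ for $t\le 1/2$, $F(t)=\ln(2t)$ for $1/2<t\le 1$, $F(t)=\ln 2$ for $1<t<\infty$, $F(\infty)=1$ (so there is an atom of mass $1-\ln 2$ at $\infty$). *)

theory Defs
  imports "HOL-Probability.Probability"
begin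

text \<open>Graphs are given by their adjacency relation; the type \<open>'v\<close> is the set of sites.\<close>

definition nbrs :: "('v \<Rightarrow> 'v \<Rightarrow> bool) \<Rightarrow> 'v \<Rightarrow> 'v set" where
  "nbrs adj i = {j. adj i j}"

definition arcs :: "('v \<Rightarrow> 'v \<Rightarrow> bool) \<Rightarrow> ('v \<times> 'v) set" where
  "arcs adj = {(i, j). j \<in> nbrs adj i}"

definition connected_set :: "('v \<Rightarrow> 'v \<Rightarrow> bool) \<Rightarrow> 'v set \<Rightarrow> bool" where
  "connected_set adj S \<longleftrightarrow>
     (\<forall>x\<in>S. \<forall>y\<in>S. (\<lambda>a b. a \<in> S \<and> b \<in> S \<and> adj a b)\<^sup>*\<^sup>* x y)"

definition graph_cycle :: "('v \<Rightarrow> 'v \<Rightarrow> bool) \<Rightarrow> 'v list \<Rightarrow> bool" where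
  "graph_cycle adj xs \<longleftrightarrow>
     3 \<le> length xs \<and> distinct xs \<and> successively adj xs \<and> adj (last xs) (hd xs)"

text \<open>The 3-regular tree is unique up to isomorphism, and automatically infinite.\<close>

definition three_regular_tree :: "('v \<Rightarrow> 'v \<Rightarrow> bool) \<Rightarrow> bool" where
  "three_regular_tree adj \<longleftrightarrow>
     symp adj \<and> irreflp adj \<and>
     connected_set adj UNIV \<and> (\<nexists>xs. graph_cycle adj xs) \<and>
     (\<forall>i. card (nbrs adj i) = 3)"

definition automorphism :: "('v \<Rightarrow> 'v \<Rightarrow> bool) \<Rightarrow> ('v \<Rightarrow> 'v) \<Rightarrow> bool" where
  "automorphism adj \<phi> \<longleftrightarrow> bij \<phi> \<and> (\<forall>i j. adj (\<phi> i) (\<phi> j) \<longleftrightarrow> adj i j)"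

definition I_set :: "ereal set" where
  "I_set = {ereal (1/2)..ereal 1} \<union> {\<infinity>}"

text \<open>Only the values for \<open>x, y \<in> I_set\<close> and \<open>z \<in> {0..1}\<close> are meaningful.\<close>

definition Phi :: "ereal \<Rightarrow> ereal \<Rightarrow> real \<Rightarrow> ereal" where
  "Phi x y z =
     (if x \<ge> ereal z then x
      else if x < ereal z \<and> ereal z \<le> y then y
      else \<infinity>)"

definition F_dist :: "ereal \<Rightarrow> real" where
  "F_dist t =
     (if t \<le> ereal (1/2) then 0
      else if t \<le> ereal 1 then ln (2 * real_of_ereal t)
      else if t < \<infinity> then ln 2
      else 1)"

definition has_distribution_function ::
    "'w measure \<Rightarrow> ('w \<Rightarrow> ereal) \<Rightarrow> (ereal \<Rightarrow> real) \<Rightarrow> bool" where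
  "has_distribution_function P X G \<longleftrightarrow>
     X \<in> borel_measurable P \<and> (\<forall>t. measure P {\<omega> \<in> space P. X \<omega> \<le> t} = G t)"

text \<open>A joint law of the family is a probability measure on the product space
  \<open>[0,1]\<close>-per-site times \<open>I\<close>-per-arc; the variables are the coordinate maps.\<close>

type_synonym 'v config = "('v \<Rightarrow> real) \<times> ('v \<times> 'v \<Rightarrow> ereal)"

definition config_space :: "('v \<Rightarrow> 'v \<Rightarrow> bool) \<Rightarrow> 'v config measure" where
  "config_space adj =
     (\<Pi>\<^sub>M i\<in>UNIV. restrict_space borel {0..1}) \<Otimes>\<^sub>M
     (\<Pi>\<^sub>M e\<in>arcs adj. restrict_space borel I_set)"

definition U_var :: "'v \<Rightarrow> 'v config \<Rightarrow> real" where
  "U_var i \<omega> = fst \<omega> i"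

text \<open>\<open>Y_var i j\<close> is \<open>Y\<^bsub>i\<rightarrow>j\<^esub>\<close>, for neighbouring sites \<open>i\<close> and \<open>j\<close>.\<close>

definition Y_var :: "'v \<Rightarrow> 'v \<Rightarrow> 'v config \<Rightarrow> ereal" where
  "Y_var i j \<omega> = snd \<omega> (i, j)"

definition relabel ::
    "('v \<Rightarrow> 'v \<Rightarrow> bool) \<Rightarrow> ('v \<Rightarrow> 'v) \<Rightarrow> 'v config \<Rightarrow> 'v config" where
  "relabel adj \<phi> \<omega> =
     (\<lambda>i. U_var (\<phi> i) \<omega>, \<lambda>(i, j)\<in>arcs adj. Y_var (\<phi> i) (\<phi> j) \<omega>)"

definition automorphism_invariant ::
    "('v \<Rightarrow> 'v \<Rightarrow> bool) \<Rightarrow> 'v config measure \<Rightarrow> bool" where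
  "automorphism_invariant adj P \<longleftrightarrow>
     (\<forall>\<phi>. automorphism adj \<phi> \<longrightarrow> distr P (config_space adj) (relabel adj \<phi>) = P)"

definition out_arcs :: "('v \<Rightarrow> 'v \<Rightarrow> bool) \<Rightarrow> 'v set \<Rightarrow> ('v \<times> 'v) set" where
  "out_arcs adj S = {(i, j). i \<in> S \<and> j \<notin> S \<and> j \<in> nbrs adj i}"

text \<open>Same as the library's \<open>indep_var\<close>, which requires both variables to have the
  same value type.\<close>

definition indep_pair ::
    "'w measure \<Rightarrow> 'a measure \<Rightarrow> ('w \<Rightarrow> 'a) \<Rightarrow> 'b measure \<Rightarrow> ('w \<Rightarrow> 'b) \<Rightarrow> bool" where
  "indep_pair P A X B Z \<longleftrightarrow>
     X \<in> measurable P A \<and> Z \<in> measurable P B \<and>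
     prob_space.indep_set P
       {X -` C \<inter> space P |C. C \<in> sets A} {Z -` D \<inter> space P |D. D \<in> sets B}"

end

theory Submission imports Defs begin

text \<open>
  The law \<open>F\<close> is a fixed point of the recursion: if the two inputs are independent with law \<open>F\<close>
  and \<open>U\<close> is an independent uniform variable, then the output has law \<open>F\<close> again. Hence, if the
  messages entering a finite connected set \<open>S \<union> {v}\<close> from outside and the uniform variables
  in it are independent with the right marginals, the same holds for \<open>S\<close>. In a tree, these data
  determine all messages inside \<open>S\<close>, so there is a unique law of the variables attached to \<open>S\<close>,
  and these laws are consistent. The recursion does not determine the messages from the uniform
  variables alone, so the global law comes from Kolmogorov's extension theorem.
  Its automorphism invariance follows from uniqueness of the local laws.

  Kolmogorov's theorem needs a Polish value space, so the point \<open>\<infinity>\<close> of \<open>I\<close> is coded by the real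
  number \<open>2\<close> until the end. Uniform variables and messages are the coordinates \<open>Inl i\<close> and
  \<open>Inr (i, j)\<close> of one product space.
\<close>

section \<open>The fixed-point law\<close>

text \<open>Information runs against the arrow: \<open>Y_var j i\<close> is computed at
  \<open>i\<close> from the arcs leaving \<open>i\<close> towards its other two neighbours. So an
  arc leaving a set carries what comes from outside, and the out-arcs are the boundary data of a
  set. Why \<open>F\<close> is a fixed point: take t in [1/2, 1] and L = F(t) = ln (2 t). The output
  is at most t iff U is at most the largest input not exceeding t. Write an input as exp V / 2 with
  V uniform, as is possible below level L. The largest V up to L is at most l iff no V lies in (l,
  L], which has probability (1 - L + l)^2. This gives the density 2 (1 - L + l) on [0, L], so the
  output is at most t with probability equal to the integral of exp l (1 - L + l) over [0, L]. The
  integrand is the derivative of (l - L) exp l, and the value is L again. The factor 1/2 in the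
  quantile function cancels the 2 that comes from having two inputs. Below, the same integral is
  computed over the two inputs in turn.\<close>

abbreviation (input) U01 :: "real measure" where
  "U01 \<equiv> uniform_measure lborel {0..1}"

text \<open>The quantile function of \<open>F\<close>, with \<open>\<infinity>\<close> coded as \<open>2\<close>.\<close>

definition quant :: "real \<Rightarrow> real" where
  "quant v = (if v \<le> ln 2 then exp v / 2 else 2)"

definition nu :: "real measure" where
  "nu = distr U01 borel quant"

definition coded_I :: "real set" where
  "coded_I = {1/2..1} \<union> {2}"

text \<open>Symmetric in the two inputs, unlike \<open>Phi\<close>, so that the neighbours of a site
  need no order. The code 2 lies above every threshold in [0,1], as infinity does.\<close>

definition phi :: "real \<Rightarrow> real \<Rightarrow> real \<Rightarrow> real" where
  "phi x y u = (if u \<le> min x y then min x y else if u \<le> max x y then max x y else 2)"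

lemma quant_measurable [measurable]: "quant \<in> borel_measurable borel"
  unfolding quant_def by measurable

lemma phi_measurable [measurable]:
  assumes [measurable]: "f \<in> borel_measurable N" "g \<in> borel_measurable N" "h \<in> borel_measurable N"
  shows "(\<lambda>x. phi (f x) (g x) (h x)) \<in> borel_measurable N"
  unfolding phi_def by measurable

lemma prob_space_U01: "prob_space U01"
  by (rule prob_space_uniform_measure) auto

lemma prob_space_nu: "prob_space nu"
  unfolding nu_def by (intro prob_space.prob_space_distr prob_space_U01) simp

lemma sets_nu [simp, measurable_cong]: "sets nu = sets borel"
  by (simp add: nu_def)

lemma space_nu [simp]: "space nu = UNIV"
  by (simp add: nu_def)

lemma AE_U01: "AE v in U01. v \<in> {0..1}"
  by (rule AE_uniform_measureI) auto

lemma quant_le_iff: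
  assumes "t \<in> {1/2..1}"
  shows "quant v \<le> t \<longleftrightarrow> v \<le> ln (2 * t)"
proof -
  have "ln (2 * t) \<le> ln 2" using assms by simp
  moreover have "exp v / 2 \<le> t \<longleftrightarrow> v \<le> ln (2 * t)"
    using assms ln_ge_iff[of "2 * t" v] by auto
  ultimately show ?thesis using assms unfolding quant_def atLeastAtMost_iff by (smt (verit))
qed

lemma quant_in_coded_I:
  assumes "v \<ge> 0"
  shows "quant v \<in> coded_I"
proof -
  have "exp v \<le> 2" if "v \<le> ln 2" using that by (metis exp_le_cancel_iff exp_ln zero_less_numeral)
  then show ?thesis using assms by (auto simp: quant_def coded_I_def)
qed

lemma coded_I_measurable [measurable]: "coded_I \<in> sets borel"
  by (auto simp: coded_I_def)

lemma AE_nu: "AE x in nu. x \<in> coded_I"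
  unfolding nu_def
  by (subst AE_distr_iff) (use AE_U01 in \<open>auto elim!: eventually_mono intro: quant_in_coded_I\<close>)

lemma phi_in_coded_I: "x \<in> coded_I \<Longrightarrow> y \<in> coded_I \<Longrightarrow> phi x y u \<in> coded_I"
  by (auto simp: phi_def coded_I_def min_def max_def)

lemma emeasure_U01_atMost:
  assumes "c \<in> {0..1}"
  shows "emeasure U01 {..c} = ennreal c"
proof -
  have "{0..1} \<inter> {..c} = {0..c}" using assms by auto
  then show ?thesis using assms by (subst emeasure_uniform_measure) (auto simp: divide_ennreal_def)
qed

lemma emeasure_nu_atMost:
  assumes "t \<in> {1/2..1}"
  shows "emeasure nu {..t} = ennreal (ln (2 * t))"
proof -
  have "ln (2 * t) \<le> ln 2" using assms by simp
  moreover have "ln 2 \<le> (1::real)" using ln_le_minus_one[of "2::real"] by simp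
  ultimately have "ln (2 * t) \<le> 1" by linarith
  then have "ln (2 * t) \<in> {0..1}" using assms by simp
  moreover have "quant -` {..t} = {..ln (2 * t)}" using quant_le_iff[OF assms] by auto
  ultimately show ?thesis
    by (simp add: nu_def emeasure_distr emeasure_U01_atMost del: emeasure_uniform_measure)
qed

lemma nn_integral_U01:
  fixes f :: "real \<Rightarrow> real"
  assumes [measurable]: "f \<in> borel_measurable borel" and "\<And>v. v \<in> {0..1} \<Longrightarrow> 0 \<le> f v"
    and "(f has_integral c) {0..1}"
  shows "(\<integral>\<^sup>+v. ennreal (f v) \<partial>U01) = ennreal c"
proof -
  let ?g = "\<lambda>v. if v \<in> {0..1} then f v else 0"
  have "(\<integral>\<^sup>+v. ennreal (f v) \<partial>U01) = (\<integral>\<^sup>+v. ennreal (?g v) \<partial>lborel)"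
    by (subst nn_integral_uniform_measure)
       (auto simp: divide_ennreal_def intro!: nn_integral_cong split: split_indicator)
  also have "\<dots> = ennreal c"
    using assms by (intro nn_integral_has_integral_lborel) (auto simp only: has_integral_restrict_UNIV, auto)
  finally show ?thesis .
qed

text \<open>Given that the two inputs are the images of \<open>a\<close> and \<open>b\<close> under \<open>quant\<close>, this is the
  conditional probability that \<open>phi\<close> does not exceed \<open>exp L / 2\<close>.\<close>

definition accept :: "real \<Rightarrow> real \<Rightarrow> real \<Rightarrow> real" where
  "accept L a b = (if a \<le> L \<and> b \<le> L then exp (max a b) / 2
     else if a \<le> L then exp a / 2 else if b \<le> L then exp b / 2 else 0)"

lemma accept_measurable [measurable]:
  assumes [measurable]: "f \<in> borel_measurable N" "g \<in> borel_measurable N"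
  shows "(\<lambda>x. accept L (f x) (g x)) \<in> borel_measurable N"
  unfolding accept_def by measurable

text \<open>Inputs up to \<open>t\<close> are tried before those above \<open>t\<close>, so the
  output stays below \<open>t\<close> exactly if \<open>u\<close> does not exceed the largest input
  that is at most \<open>t\<close>.\<close>

lemma nn_integral_phi_le:
  assumes t: "t \<in> {1/2..1}"
  shows "(\<integral>\<^sup>+u. indicator {..t} (phi (quant a) (quant b) u) \<partial>U01) = ennreal (accept (ln (2 * t)) a b)"
proof -
  define L where "L = ln (2 * t)"
  have L: "exp L = 2 * t" "L \<le> ln 2" using t by (auto simp: L_def)
  have le: "quant v \<le> t \<longleftrightarrow> v \<le> L" for v using quant_le_iff[OF t] by (simp add: L_def)
  have q: "quant v = exp v / 2" if "v \<le> L" for v using that L by (simp add: quant_def)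
  have m: "quant v \<le> quant w" if "v \<le> w" "w \<le> L" for v w using that by (simp add: q)
  have t2: "t < 2" using t by simp
  have acc: "accept L a b \<in> {0..1}"
  proof -
    have "exp v / 2 \<le> 1" if "v \<le> L" for v
      using that L t by (metis atLeastAtMost_iff divide_le_eq_1 exp_le_cancel_iff le order.trans q zero_less_numeral
        divide_le_eq_1_pos)
    then show ?thesis by (auto simp: accept_def max_def)
  qed
  \<comment> \<open>The null point \<open>u = 0\<close> must be left out: if both inputs exceed
    \<open>t\<close>, \<open>accept\<close> is 0 and \<open>{..0}\<close> would still contain
    it.\<close>
  have "phi (quant a) (quant b) u \<le> t \<longleftrightarrow> u \<le> accept L a b" if "u > 0" for u
    using le[of a] le[of b] q[of a] q[of b] m[of a b] m[of b a] t2 that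
    by (auto simp: phi_def accept_def min_def max_def split: if_splits)
  then have "(\<integral>\<^sup>+u. indicator {..t} (phi (quant a) (quant b) u) \<partial>U01) = (\<integral>\<^sup>+u. indicator {..accept L a b} u \<partial>U01)"
  proof (intro nn_integral_cong_AE)
    have "AE u in U01. u > 0"
      by (rule AE_uniform_measureI)
        (auto intro!: eventually_mono[OF AE_lborel_singleton[of 0]])
    then show "AE u in U01. (indicator {..t} (phi (quant a) (quant b) u) :: ennreal) = indicator {..accept L a b} u"
      using \<open>\<And>u. u > 0 \<Longrightarrow> _\<close> by (auto elim!: eventually_mono split: split_indicator)
  qed
  also have "\<dots> = ennreal (accept L a b)"
    using emeasure_U01_atMost[OF acc] by (simp del: emeasure_uniform_measure)
  finally show ?thesis by (simp add: L_def)
qed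

text \<open>With \<open>a\<close> accepted, the largest accepted level is \<open>a\<close> for
  \<open>b\<close> up to \<open>a\<close>, then \<open>b\<close> up to \<open>L\<close>, then
  \<open>a\<close> again. With \<open>a\<close> rejected, only \<open>b\<close> up to
  \<open>L\<close> contributes.\<close>

lemma has_integral_accept_inner:
  assumes L: "0 \<le> L" "L \<le> 1" and a: "0 \<le> a"
  shows "(accept L a has_integral
    (if a \<le> L then (a * exp a + (exp L - exp a) + (1 - L) * exp a) / 2 else (exp L - 1) / 2)) {0..1}"
proof -
  have E: "((\<lambda>v::real. exp v / 2) has_integral (exp d / 2 - exp c / 2)) {c..d}" if "c \<le> d" for c d
    using that by (intro fundamental_theorem_of_calculus)
      (auto intro!: derivative_eq_intros simp flip: has_real_derivative_iff_has_vector_derivative)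
  have C: "((\<lambda>v::real. k) has_integral (d - c) * k) {c..d}" if "c \<le> d" for c d k :: real
    using has_integral_const_real[of k c d] that by simp
  show ?thesis
  proof (cases "a \<le> L")
    case True
    have 1: "(accept L a has_integral (a - 0) * (exp a / 2)) {0..a}"
      by (rule has_integral_eq[OF _ C]) (use True a in \<open>auto simp: accept_def max_def\<close>)
    have 2: "(accept L a has_integral (exp L / 2 - exp a / 2)) {a..L}"
      by (rule has_integral_eq[OF _ E]) (use True in \<open>auto simp: accept_def max_def\<close>)
    \<comment> \<open>At \<open>b = L\<close> the second input is still accepted, so the constant
      may be wrong at this one point.\<close>
    have 3: "(accept L a has_integral (1 - L) * (exp a / 2)) {L..1}"
      by (rule has_integral_spike_finite[of "{L}", OF _ _ C]) (use True L in \<open>auto simp: accept_def max_def\<close>)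
    have eq: "(a - 0) * (exp a / 2) + (exp L / 2 - exp a / 2) + (1 - L) * (exp a / 2)
        = (a * exp a + (exp L - exp a) + (1 - L) * exp a) / 2"
      by (simp add: field_simps)
    show ?thesis
      using has_integral_combine[OF _ _ has_integral_combine[OF _ _ 1 2] 3] a True L
      unfolding eq by simp
  next
    case False
    have 1: "(accept L a has_integral (exp L / 2 - exp 0 / 2)) {0..L}"
      by (rule has_integral_eq[OF _ E]) (use False L in \<open>auto simp: accept_def max_def\<close>)
    have 2: "(accept L a has_integral (1 - L) * 0) {L..1}"
      by (rule has_integral_spike_finite[of "{L}", OF _ _ C]) (use False L in \<open>auto simp: accept_def max_def\<close>)
    show ?thesis
      using has_integral_combine[OF _ _ 1 2] False L
      by (simp add: field_simps)
  qed
qed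

lemma has_integral_accept_outer:
  fixes L :: real
  assumes L: "0 \<le> L" "L \<le> 1"
  shows "((\<lambda>a. if a \<le> L then (a * exp a + (exp L - exp a) + (1 - L) * exp a) / 2 else (exp L - 1) / 2)
    has_integral L) {0..1}" (is "(?f has_integral _) _")
proof -
  \<comment> \<open>An antiderivative of the first branch; its boundary terms and the constant
    branch on \<open>{L..1}\<close> add up to \<open>L\<close>.\<close>
  let ?F = "\<lambda>a. (a * exp a - exp a + a * exp L - L * exp a) / 2"
  have "((\<lambda>a. (a * exp a + (exp L - exp a) + (1 - L) * exp a) / 2) has_integral (?F L - ?F 0)) {0..L}"
    using L by (intro fundamental_theorem_of_calculus)
      (auto intro!: derivative_eq_intros simp: field_simps simp flip: has_real_derivative_iff_has_vector_derivative)
  then have 1: "(?f has_integral (?F L - ?F 0)) {0..L}"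
    by (rule has_integral_eq[rotated]) auto
  have "((\<lambda>a. (exp L - 1) / 2) has_integral (1 - L) * ((exp L - 1) / 2)) {L..1}"
    using has_integral_const_real[of "(exp L - 1) / 2" L 1] L by simp
  then have 2: "(?f has_integral (1 - L) * ((exp L - 1) / 2)) {L..1}"
    by (rule has_integral_spike_finite[of "{L}", rotated 2]) auto
  show ?thesis
    using has_integral_combine[OF _ _ 1 2] L by (simp add: field_simps)
qed

lemma distr_phi: "distr (nu \<Otimes>\<^sub>M (nu \<Otimes>\<^sub>M U01)) borel (\<lambda>(x, y, u). phi x y u) = nu" (is "?N = _")
proof -
  interpret U: prob_space U01 by (rule prob_space_U01)
  interpret N: prob_space nu by (rule prob_space_nu)
  interpret NU: pair_prob_space nu U01 ..
  interpret NNU: pair_prob_space nu "nu \<Otimes>\<^sub>M U01" ..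
  have [measurable_cong]: "sets U01 = sets borel" by simp
  have phi_m [measurable]: "(\<lambda>(x, y, u). phi x y u) \<in> borel_measurable (nu \<Otimes>\<^sub>M (nu \<Otimes>\<^sub>M U01))"
    by measurable
  interpret N': prob_space ?N by (rule NNU.prob_space_distr) measurable
  have rd: "real_distribution ?N" "real_distribution nu"
    using N'.prob_space_axioms N.prob_space_axioms
    by (auto simp: real_distribution_def real_distribution_axioms_def)
  \<comment> \<open>Both laws sit on \<open>coded_I\<close>. Its gaps make the two distribution
    functions constant off [1/2, 1] except for the jump at 2, so only \<open>t\<close> in this
    interval needs a computation.\<close>
  have AE_N: "AE x in ?N. x \<in> coded_I"
  proof (subst AE_distr_iff)
    show "AE z in nu \<Otimes>\<^sub>M (nu \<Otimes>\<^sub>M U01). (case z of (x, y, u) \<Rightarrow> phi x y u) \<in> coded_I"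
    proof (rule NNU.AE_pair_measure)
      show "AE x in nu. AE yu in nu \<Otimes>\<^sub>M U01. (case (x, yu) of (x, y, u) \<Rightarrow> phi x y u) \<in> coded_I"
        using AE_nu
      proof (rule eventually_mono)
        fix x assume x: "x \<in> coded_I"
        show "AE yu in nu \<Otimes>\<^sub>M U01. (case (x, yu) of (x, y, u) \<Rightarrow> phi x y u) \<in> coded_I"
        proof (rule NU.AE_pair_measure)
          show "AE y in nu. AE u in U01. (case (x, y, u) of (x, y, u) \<Rightarrow> phi x y u) \<in> coded_I"
            using AE_nu by (rule eventually_mono) (use x in \<open>auto intro: phi_in_coded_I\<close>)
        qed measurable
      qed
    qed measurable
  qed measurable
  have main: "emeasure ?N {..t} = emeasure nu {..t}" if t: "t \<in> {1/2..1}" for t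
  proof -
    define L where "L = ln (2 * t)"
    have "ln (2 * t) \<le> ln 2" using t by simp
    moreover have "ln 2 \<le> (1::real)" using ln_le_minus_one[of "2::real"] by simp
    ultimately have "ln (2 * t) \<le> 1" by linarith
    then have L: "0 \<le> L" "L \<le> 1" using t by (simp_all add: L_def)
    have nonneg: "0 \<le> accept L a b" for a b by (simp add: accept_def)
    let ?h = "\<lambda>a. if a \<le> L then (a * exp a + (exp L - exp a) + (1 - L) * exp a) / 2 else (exp L - 1) / 2"
    have "emeasure ?N {..t} = (\<integral>\<^sup>+z. indicator {..t} z \<partial>?N)" by simp
    also have "\<dots> = (\<integral>\<^sup>+z. indicator {..t} (case z of (x, y, u) \<Rightarrow> phi x y u) \<partial>(nu \<Otimes>\<^sub>M (nu \<Otimes>\<^sub>M U01)))"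
      by (rule nn_integral_distr[OF phi_m]) simp
    also have "\<dots> = (\<integral>\<^sup>+x. \<integral>\<^sup>+y. \<integral>\<^sup>+u. indicator {..t} (phi x y u) \<partial>U01 \<partial>nu \<partial>nu)"
      by (simp add: U.nn_integral_fst[symmetric] NU.nn_integral_fst[symmetric])
    also have "\<dots> = (\<integral>\<^sup>+a. \<integral>\<^sup>+b. \<integral>\<^sup>+u. indicator {..t} (phi (quant a) (quant b) u) \<partial>U01 \<partial>U01 \<partial>U01)"
      unfolding nu_def by (simp add: nn_integral_distr)
    also have "\<dots> = (\<integral>\<^sup>+a. \<integral>\<^sup>+b. ennreal (accept L a b) \<partial>U01 \<partial>U01)"
      by (simp only: nn_integral_phi_le[OF t] L_def)
    also have "\<dots> = (\<integral>\<^sup>+a. ennreal (?h a) \<partial>U01)"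
    proof (rule nn_integral_cong_AE, rule eventually_mono[OF AE_U01])
      fix a :: real assume "a \<in> {0..1}"
      then show "(\<integral>\<^sup>+b. ennreal (accept L a b) \<partial>U01) = ennreal (?h a)"
        by (intro nn_integral_U01 has_integral_accept_inner L nonneg) auto
    qed
    also have "\<dots> = ennreal L"
    proof (rule nn_integral_U01[OF _ _ has_integral_accept_outer[OF L]])
      show "0 \<le> ?h a" if "a \<in> {0..1}" for a
        using has_integral_nonneg[OF has_integral_accept_inner[OF L]] nonneg that by force
    qed measurable
    also have "\<dots> = emeasure nu {..t}" using emeasure_nu_atMost[OF t] by (simp add: L_def)
    finally show ?thesis .
  qed
  have cong: "emeasure K {..t} = emeasure K {..s}"
    if "AE x in K. x \<in> coded_I" "sets K = sets borel" "\<And>x. x \<in> coded_I \<Longrightarrow> x \<le> t \<longleftrightarrow> x \<le> s" for K s t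
    by (rule emeasure_eq_AE) (use that in \<open>auto elim!: eventually_mono\<close>)
  have "emeasure ?N {..t} = emeasure nu {..t}" for t
  proof -
    consider "t < 1/2" | "t \<in> {1/2..1}" | "1 < t" "t < 2" | "2 \<le> t" by force
    then show ?thesis
    proof cases
      case 1
      have "emeasure K {..t} = 0" if "AE x in K. x \<in> coded_I" "sets K = sets borel" for K
        by (rule emeasure_eq_0_AE[where P="\<lambda>x. x \<le> t" and M=K, unfolded sets_eq_imp_space_eq[OF that(2)], simplified, folded atMost_def])
          (use 1 that(1) in \<open>auto elim!: eventually_mono simp: coded_I_def\<close>)
      from this[OF AE_N] this[OF AE_nu] show ?thesis by simp
    next
      case 2 then show ?thesis by (rule main)
    next
      case 3
      then have "x \<in> coded_I \<Longrightarrow> x \<le> t \<longleftrightarrow> x \<le> 1" for x by (auto simp: coded_I_def)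
      with cong[OF AE_N, of t 1] cong[OF AE_nu, of t 1] main[of 1] show ?thesis by simp
    next
      case 4
      have "emeasure K {..t} = emeasure K UNIV" if "AE x in K. x \<in> coded_I" "sets K = sets borel" for K
        by (rule emeasure_eq_AE) (use 4 that in \<open>auto elim!: eventually_mono simp: coded_I_def\<close>)
      from this[OF AE_N] this[OF AE_nu] show ?thesis
        using N'.emeasure_space_1 N.emeasure_space_1 by simp
    qed
  qed
  then have "cdf ?N = cdf nu" by (simp add: cdf_def measure_def fun_eq_iff)
  with rd show ?thesis by (intro cdf_unique)
qed

section \<open>Connected sets in the tree\<close>

lemma rtranclp_imp_distinct_path:
  assumes "r\<^sup>*\<^sup>* x y"
  shows "\<exists>xs. xs \<noteq> [] \<and> distinct xs \<and> successively r xs \<and> hd xs = x \<and> last xs = y"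
  using assms
proof (induction rule: converse_rtranclp_induct)
  case base
  show ?case by (intro exI[of _ "[y]"]) simp
next
  case (step x z)
  then obtain xs where xs: "xs \<noteq> []" "distinct xs" "successively r xs" "hd xs = z" "last xs = y"
    by blast
  show ?case
  proof (cases "x \<in> set xs")
    \<comment> \<open>The new start already lies on the path: dropping everything before it removes
      the loop.\<close>
    case True
    then obtain ys zs where "xs = ys @ x # zs" by (meson split_list)
    with xs show ?thesis
      by (intro exI[of _ "x # zs"]) (auto simp: successively_append_iff)
  next
    case False
    with xs step(1) show ?thesis
      by (intro exI[of _ "x # xs"]) (auto simp: successively_Cons)
  qed
qed

locale bethe_lattice =
  fixes adj :: "'v \<Rightarrow> 'v \<Rightarrow> bool"
  assumes tree: "three_regular_tree adj"
begin

lemma adj_sym: "adj i j \<Longrightarrow> adj j i"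
  using tree by (auto simp: three_regular_tree_def symp_def)

lemma adj_irrefl: "\<not> adj i i"
  using tree by (auto simp: three_regular_tree_def irreflp_def)

lemma finite_nbrs: "finite (nbrs adj i)"
  using tree by (intro card_ge_0_finite) (auto simp: three_regular_tree_def)

lemma other_nbrs:
  assumes "adj i j"
  obtains k l where "k \<noteq> l" "nbrs adj i - {j} = {k, l}"
proof -
  have "card (nbrs adj i) = 3" using tree by (auto simp: three_regular_tree_def)
  then have "card (nbrs adj i - {j}) = 2" using assms by (simp add: nbrs_def)
  then show ?thesis using that by (auto simp: card_2_iff)
qed

text \<open>A path in \<open>S\<close> between two distinct neighbours of \<open>v\<close> would
  close up to a cycle through \<open>v\<close>. Hence a site attached to a connected set is a leaf
  of the enlarged set.\<close>

lemma unique_nbr_in_connected: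
  assumes S: "connected_set adj S" and uw: "u \<in> S" "w \<in> S" and v: "v \<notin> S" "adj u v" "adj w v"
  shows "u = w"
proof (rule ccontr)
  assume "u \<noteq> w"
  let ?r = "\<lambda>a b. a \<in> S \<and> b \<in> S \<and> adj a b"
  have "?r\<^sup>*\<^sup>* u w" using S uw by (auto simp: connected_set_def)
  from rtranclp_imp_distinct_path[OF this] obtain xs where
    xs: "xs \<noteq> []" "distinct xs" "successively ?r xs" "hd xs = u" "last xs = w" by blast
  then obtain ys where ys: "xs = u # ys" "ys \<noteq> []" using \<open>u \<noteq> w\<close> by (cases xs) (auto split: if_splits)
  have inS: "set zs \<subseteq> S" if "successively ?r zs" "hd zs \<in> S" for zs
    using that by (induction zs rule: induct_list012) auto
  have "successively adj xs" using xs(3) by (rule successively_mono) auto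
  then have "graph_cycle adj (v # xs)"
    using ys xs v inS[OF xs(3)] uw adj_sym
    by (auto simp: graph_cycle_def successively_Cons Suc_le_eq)
  then show False using tree by (auto simp: three_regular_tree_def)
qed

lemma connected_insert:
  assumes "connected_set adj S" "u \<in> S" "adj u v"
  shows "connected_set adj (insert v S)"
proof -
  let ?r = "\<lambda>a b. a \<in> insert v S \<and> b \<in> insert v S \<and> adj a b"
  have S: "?r\<^sup>*\<^sup>* x y" if "x \<in> S" "y \<in> S" for x y
  proof -
    have "(\<lambda>a b. a \<in> S \<and> b \<in> S \<and> adj a b)\<^sup>*\<^sup>* x y"
      using assms(1) that by (auto simp: connected_set_def)
    then show ?thesis by (rule rtranclp_mono[THEN predicate2D, rotated]) auto
  qed
  have uv: "?r\<^sup>*\<^sup>* u v" "?r\<^sup>*\<^sup>* v u" using assms adj_sym by auto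
  show ?thesis
    unfolding connected_set_def
    using S uv assms(2) by (auto intro: rtranclp_trans)
qed

lemma connected_singleton: "connected_set adj {i}"
  by (simp add: connected_set_def)

text \<open>Each new point is reached by a path whose sites are added one by one, so connectedness
  is never lost.\<close>

lemma finite_connected_superset:
  assumes "finite K"
  shows "\<exists>S. finite S \<and> connected_set adj S \<and> S \<noteq> {} \<and> K \<subseteq> S"
  using assms
proof (induction K rule: finite_induct)
  case empty
  show ?case by (intro exI[of _ "{undefined}"]) (simp add: connected_singleton)
next
  case (insert x K)
  then obtain S s where S: "finite S" "connected_set adj S" "s \<in> S" "K \<subseteq> S" by blast
  have "adj\<^sup>*\<^sup>* s x" using tree by (simp add: three_regular_tree_def connected_set_def)
  then have "\<exists>S'. finite S' \<and> connected_set adj S' \<and> S \<subseteq> S' \<and> x \<in> S'"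
  proof (induction rule: rtranclp_induct)
    case base
    then show ?case using S by blast
  next
    case (step y z)
    then obtain S' where "finite S'" "connected_set adj S'" "S \<subseteq> S'" "y \<in> S'" by blast
    with step(2) show ?case
      by (intro exI[of _ "insert z S'"]) (auto intro: connected_insert)
  qed
  with S show ?case by blast
qed

lemma boundary_edge_exists:
  assumes S: "connected_set adj S" and S0: "S0 \<subseteq> S" "S0 \<noteq> {}" "S0 \<noteq> S"
  shows "\<exists>u v. u \<in> S0 \<and> v \<in> S - S0 \<and> adj u v"
proof -
  from S0 obtain s x where sx: "s \<in> S0" "x \<in> S - S0" by blast
  then have "(\<lambda>a b. a \<in> S \<and> b \<in> S \<and> adj a b)\<^sup>*\<^sup>* s x"
    using S S0 by (auto simp: connected_set_def)
  then have "x \<in> S0 \<or> (\<exists>u v. u \<in> S0 \<and> v \<in> S - S0 \<and> adj u v)"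
    by (induction rule: rtranclp_induct) (use sx in auto)
  with sx show ?thesis by blast
qed

text \<open>A boundary edge always supplies the next site, and the number of missing sites
  decreases. A singleton start serves to solve the recursion, a general \<open>S0\<close> to compare
  laws on nested sets.\<close>

lemma connected_growth_induct [consumes 5, case_names base step]:
  assumes fin: "finite S" and S: "connected_set adj S" and S0: "connected_set adj S0" "S0 \<subseteq> S" "S0 \<noteq> {}"
    and base: "R S0"
    and step: "\<And>T u v. connected_set adj T \<Longrightarrow> finite T \<Longrightarrow> T \<noteq> {} \<Longrightarrow> u \<in> T \<Longrightarrow> v \<notin> T \<Longrightarrow> adj u v
       \<Longrightarrow> R T \<Longrightarrow> R (insert v T)"
  shows "R S"
proof -
  have "R S" if "connected_set adj T" "T \<subseteq> S" "T \<noteq> {}" "R T" for T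
    using that
  proof (induction "card (S - T)" arbitrary: T rule: less_induct)
    case less
    show ?case
    proof (cases "T = S")
      case False
      then obtain u v where uv: "u \<in> T" "v \<in> S - T" "adj u v"
        using boundary_edge_exists[OF S] less.prems by blast
      have "S - insert v T \<subset> S - T" using uv by blast
      then have lt: "card (S - insert v T) < card (S - T)" using fin by (intro psubset_card_mono) auto
      have "finite T" using fin less.prems by (auto intro: finite_subset)
      then have "R (insert v T)" using uv less.prems by (intro step) auto
      then show ?thesis using lt uv less.prems by (intro less.hyps[of "insert v T"] connected_insert) auto
    qed (use less in simp)
  qed
  with S0 base show ?thesis by blast
qed

end

section \<open>Laws attached to finite connected sets\<close>

lemma distr_phi_PiM:
  fixes M :: "'i \<Rightarrow> real measure"
  assumes M: "\<And>i. prob_space (M i)" and [simp]: "M a = U01" "M b = nu" "M c = nu"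
    and dist: "a \<noteq> b" "a \<noteq> c" "b \<noteq> c"
  shows "distr (PiM {a, b, c} M) borel (\<lambda>g. phi (g b) (g c) (g a)) = nu"
proof (rule measure_eqI)
  interpret product_sigma_finite M
    using M by (simp add: product_sigma_finite_def prob_space_imp_sigma_finite)
  interpret U: prob_space U01 by (rule prob_space_U01)
  interpret N: prob_space nu by (rule prob_space_nu)
  interpret NU: pair_prob_space nu U01 ..
  have [measurable_cong]: "sets U01 = sets borel" by simp
  \<comment> \<open>Peeling off \<open>b\<close>, \<open>c\<close>, \<open>a\<close> in this order
    gives the iterated integral of the product in \<open>distr_phi\<close>.\<close>
  have perm: "{a, b, c} = {b, c, a}" by auto
  have comp: "(\<lambda>g. g i) \<in> borel_measurable (PiM J M)" if "i \<in> J" "i \<in> {a, b, c}" for i J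
    using measurable_component_singleton[OF that(1), of M] that(2) by (auto simp: measurable_def)
  have phi_m: "(\<lambda>g. phi (g b) (g c) (g a)) \<in> borel_measurable (PiM {b, c, a} M)"
    by (intro phi_measurable comp) auto
  fix A assume "A \<in> sets (distr (PiM {a, b, c} M) borel (\<lambda>g. phi (g b) (g c) (g a)))"
  then have A [measurable]: "A \<in> sets borel" by simp
  have "emeasure (distr (PiM {a, b, c} M) borel (\<lambda>g. phi (g b) (g c) (g a))) A
      = (\<integral>\<^sup>+z. indicator A z \<partial>distr (PiM {b, c, a} M) borel (\<lambda>g. phi (g b) (g c) (g a)))"
    using A by (simp add: perm)
  also have "\<dots> = (\<integral>\<^sup>+g. indicator A (phi (g b) (g c) (g a)) \<partial>PiM {b, c, a} M)"
    by (rule nn_integral_distr[OF phi_m]) simp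
  also have "\<dots> = (\<integral>\<^sup>+x. \<integral>\<^sup>+y. \<integral>\<^sup>+u. indicator A (phi x y u) \<partial>U01 \<partial>nu \<partial>nu)"
  proof -
    have 1: "(\<integral>\<^sup>+g. indicator A (phi (g b) (g c) (g a)) \<partial>PiM {b, c, a} M)
        = (\<integral>\<^sup>+x. \<integral>\<^sup>+g. indicator A (phi x (g c) (g a)) \<partial>PiM {c, a} M \<partial>nu)"
      using dist measurable_compose[OF phi_m borel_measurable_indicator[OF A]]
      by (subst product_nn_integral_insert_rev) auto
    have 2: "(\<integral>\<^sup>+g. indicator A (phi x (g c) (g a)) \<partial>PiM {c, a} M)
        = (\<integral>\<^sup>+y. \<integral>\<^sup>+g. indicator A (phi x y (g a)) \<partial>PiM {a} M \<partial>nu)" for x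
    proof -
      have "(\<lambda>g. phi x (g c) (g a)) \<in> borel_measurable (PiM {c, a} M)"
        by (intro phi_measurable comp) auto
      from measurable_compose[OF this borel_measurable_indicator[OF A]]
      show ?thesis using dist by (subst product_nn_integral_insert_rev) auto
    qed
    have 3: "(\<integral>\<^sup>+g. indicator A (phi x y (g a)) \<partial>PiM {a} M) = (\<integral>\<^sup>+u. indicator A (phi x y u) \<partial>U01)" for x y
    proof -
      have "(\<lambda>u. phi x y u) \<in> borel_measurable U01" by (intro phi_measurable measurable_ident_sets) auto
      from measurable_compose[OF this borel_measurable_indicator[OF A]]
      show ?thesis using product_nn_integral_singleton[of "\<lambda>u. indicator A (phi x y u)" a] by simp
    qed
    show ?thesis unfolding 1 2 3 ..
  qed
  also have "\<dots> = (\<integral>\<^sup>+z. indicator A (case z of (x, y, u) \<Rightarrow> phi x y u) \<partial>(nu \<Otimes>\<^sub>M (nu \<Otimes>\<^sub>M U01)))"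
    by (simp add: U.nn_integral_fst[symmetric] NU.nn_integral_fst[symmetric])
  also have "\<dots> = (\<integral>\<^sup>+z. indicator A z \<partial>distr (nu \<Otimes>\<^sub>M (nu \<Otimes>\<^sub>M U01)) borel (\<lambda>(x, y, u). phi x y u))"
  proof (rule nn_integral_distr[symmetric])
    show "(\<lambda>(x, y, u). phi x y u) \<in> borel_measurable (nu \<Otimes>\<^sub>M (nu \<Otimes>\<^sub>M U01))" by measurable
  qed simp
  also have "\<dots> = emeasure nu A"
    unfolding distr_phi by simp
  finally show "emeasure (distr (PiM {a, b, c} M) borel (\<lambda>g. phi (g b) (g c) (g a))) A = emeasure nu A" .
qed simp

abbreviation (input) real_PiM :: "'i set \<Rightarrow> ('i \<Rightarrow> real) measure" where
  "real_PiM J \<equiv> PiM J (\<lambda>_. borel)"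

definition base :: "'v + 'v \<times> 'v \<Rightarrow> real measure" where
  "base = case_sum (\<lambda>_. U01) (\<lambda>_. nu)"

lemma base_simps [simp]: "base (Inl i) = U01" "base (Inr e) = nu"
  by (simp_all add: base_def)

lemma prob_space_base: "prob_space (base e)"
  by (cases e) (simp_all add: prob_space_U01 prob_space_nu)

lemma sets_base [measurable_cong]: "sets (base e) = sets borel"
  by (cases e) simp_all

lemma sets_PiM_base [measurable_cong]: "sets (PiM J base) = sets (real_PiM J)"
  by (intro sets_PiM_cong) (simp_all add: sets_base)

section \<open>The message recursion on finite subtrees\<close>

context bethe_lattice
begin

definition idx :: "('v + 'v \<times> 'v) set" where
  "idx = range Inl \<union> Inr ` arcs adj"

text \<open>The input data of \<open>S\<close>: everything beyond an out-arc acts on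
  \<open>S\<close> only through the value on that arc.\<close>

definition free_idx :: "'v set \<Rightarrow> ('v + 'v \<times> 'v) set" where
  "free_idx S = Inl ` S \<union> Inr ` out_arcs adj S"

definition inner_idx :: "'v set \<Rightarrow> ('v + 'v \<times> 'v) set" where
  "inner_idx S = Inr ` {(i, j). i \<in> S \<and> j \<in> S \<and> adj i j}"

text \<open>\<open>message \<omega> i j\<close> is the value that the recursion at \<open>i\<close> prescribes for the reversed arc
  \<open>Inr (j, i)\<close>.\<close>

definition message :: "('v + 'v \<times> 'v \<Rightarrow> real) \<Rightarrow> 'v \<Rightarrow> 'v \<Rightarrow> real" where
  "message \<omega> i j = phi (Min ((\<lambda>k. \<omega> (Inr (i, k))) ` (nbrs adj i - {j})))
     (Max ((\<lambda>k. \<omega> (Inr (i, k))) ` (nbrs adj i - {j}))) (\<omega> (Inl i))"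

text \<open>Only arcs inside \<open>S\<close> are constrained. The messages involved read arcs
  leaving sites of \<open>S\<close>, hence coordinates in \<open>free_idx S\<close> or
  \<open>inner_idx S\<close> only.\<close>

definition recursive_on :: "'v set \<Rightarrow> ('v + 'v \<times> 'v \<Rightarrow> real) \<Rightarrow> bool" where
  "recursive_on S \<omega> \<longleftrightarrow> (\<forall>i\<in>S. \<forall>j\<in>S. adj i j \<longrightarrow> \<omega> (Inr (j, i)) = message \<omega> i j)"

text \<open>\<open>Min\<close> and \<open>Max\<close> of the set of values remain correct when the
  two values coincide, and \<open>phi\<close> does not change when its inputs are sorted.\<close>

lemma message_eq:
  assumes "nbrs adj i - {j} = {k, l}"
  shows "message \<omega> i j = phi (\<omega> (Inr (i, k))) (\<omega> (Inr (i, l))) (\<omega> (Inl i))"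
  unfolding message_def assms by (simp add: phi_def)

lemma message_cong:
  assumes "\<omega> (Inl i) = \<omega>' (Inl i)"
    and "\<And>k. adj i k \<Longrightarrow> k \<noteq> j \<Longrightarrow> \<omega> (Inr (i, k)) = \<omega>' (Inr (i, k))"
  shows "message \<omega> i j = message \<omega>' i j"
proof -
  have "(\<lambda>k. \<omega> (Inr (i, k))) ` (nbrs adj i - {j}) = (\<lambda>k. \<omega>' (Inr (i, k))) ` (nbrs adj i - {j})"
    using assms(2) by (intro image_cong) (auto simp: nbrs_def)
  then show ?thesis using assms(1) unfolding message_def by simp
qed

lemma in_idx [simp]: "Inl i \<in> idx" "Inr (i, j) \<in> idx \<longleftrightarrow> adj i j"
  by (auto simp: idx_def arcs_def nbrs_def)

lemma free_idx_iff [simp]: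
  "Inl i \<in> free_idx S \<longleftrightarrow> i \<in> S" "Inr (i, j) \<in> free_idx S \<longleftrightarrow> i \<in> S \<and> j \<notin> S \<and> adj i j"
  by (auto simp: free_idx_def out_arcs_def nbrs_def)

lemma inner_idx_iff [simp]:
  "Inl i \<notin> inner_idx S" "Inr (i, j) \<in> inner_idx S \<longleftrightarrow> i \<in> S \<and> j \<in> S \<and> adj i j"
  by (auto simp: inner_idx_def)

lemma free_subset_idx: "free_idx S \<subseteq> idx"
  by (auto simp: free_idx_def idx_def out_arcs_def arcs_def)

lemma inner_subset_idx: "inner_idx S \<subseteq> idx"
  by (auto simp: inner_idx_def idx_def arcs_def nbrs_def)

lemma finite_free: "finite S \<Longrightarrow> finite (free_idx S)"
proof -
  assume "finite S"
  then have "finite (Sigma S (nbrs adj))" using finite_nbrs by blast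
  then have "finite (out_arcs adj S)" by (rule rev_finite_subset) (auto simp: out_arcs_def)
  with \<open>finite S\<close> show ?thesis by (simp add: free_idx_def)
qed

lemma free_nonempty: "S \<noteq> {} \<Longrightarrow> free_idx S \<noteq> {}"
  by (auto simp: free_idx_def)

lemma message_measurable:
  assumes "adj i j" "Inl i \<in> J" "\<And>k. adj i k \<Longrightarrow> k \<noteq> j \<Longrightarrow> Inr (i, k) \<in> J"
    and f: "f \<in> measurable N (real_PiM J)"
  shows "(\<lambda>x. message (f x) i j) \<in> borel_measurable N"
proof -
  obtain k l where kl: "nbrs adj i - {j} = {k, l}" using other_nbrs assms(1) by metis
  then have "Inr (i, k) \<in> J" "Inr (i, l) \<in> J" using assms(3) by (auto simp: nbrs_def)
  with assms(2) f show ?thesis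
    unfolding message_eq[OF kl] by measurable
qed

lemma recursive_on_subset: "recursive_on S' \<omega> \<Longrightarrow> S \<subseteq> S' \<Longrightarrow> recursive_on S \<omega>"
  by (auto simp: recursive_on_def)

text \<open>In a tree the messages have no circular dependence, so the equations inside
  \<open>S\<close> can be solved leaf by leaf. Leaving all other coordinates alone keeps the law of
  the free data intact.\<close>

lemma exists_completion:
  assumes "finite S" "connected_set adj S" "S \<noteq> {}"
  shows "\<exists>T \<in> measurable (real_PiM idx) (real_PiM idx).
    (\<forall>\<omega>. recursive_on S (T \<omega>)) \<and> (\<forall>\<omega> e. e \<notin> inner_idx S \<longrightarrow> T \<omega> e = \<omega> e)"
proof -
  from assms(3) obtain s where s: "s \<in> S" by blast
  then have "{s} \<subseteq> S" "{s} \<noteq> {}" by auto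
  from assms(1,2) connected_singleton this show ?thesis
  proof (induction rule: connected_growth_induct)
    case base
    then show ?case
      by (intro bexI[of _ "\<lambda>\<omega>. \<omega>"]) (auto simp: recursive_on_def adj_irrefl)
  next
    case (step S u v)
    then obtain T where T [measurable]: "T \<in> measurable (real_PiM idx) (real_PiM idx)"
      and T_rec: "\<And>\<omega>. recursive_on S (T \<omega>)" and T_eq: "\<And>\<omega> e. e \<notin> inner_idx S \<Longrightarrow> T \<omega> e = \<omega> e"
      by blast
    note uv = \<open>u \<in> S\<close> \<open>v \<notin> S\<close> \<open>adj u v\<close> adj_sym[OF \<open>adj u v\<close>]
    have u_only: "i = u" if "i \<in> S" "adj i v \<or> adj v i" for i
      using unique_nbr_in_connected[OF \<open>connected_set adj S\<close> that(1) uv(1) uv(2)] that uv adj_sym by blast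
    \<comment> \<open>The message along \<open>(u, v)\<close> becomes internal and is computed from outside data, then \<open>S\<close> is
      completed, and the message along \<open>(v, u)\<close> is read off from the result.\<close>
    define w where "w \<omega> = T (fun_upd \<omega> (Inr (u, v)) (message \<omega> v u))" for \<omega>
    define T' where "T' \<omega> = (w \<omega>)(Inr (v, u) := message (w \<omega>) u v)" for \<omega>
    have upd: "(\<lambda>\<omega>. (f \<omega>)(e := h \<omega>)) \<in> measurable (real_PiM idx) (real_PiM idx)"
      if "f \<in> measurable (real_PiM idx) (real_PiM idx)" "h \<in> borel_measurable (real_PiM idx)" "e \<in> idx" for f h e
      using that by (intro measurable_fun_upd[where I=idx]) auto
    have w_m [measurable]: "w \<in> measurable (real_PiM idx) (real_PiM idx)"
      unfolding w_def
      by (intro measurable_compose[OF _ T] upd message_measurable[where J=idx]) (use uv in auto)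
    have "T' \<in> measurable (real_PiM idx) (real_PiM idx)"
      unfolding T'_def
      by (intro upd message_measurable[where J=idx] w_m) (use uv in auto)
    moreover have "T' \<omega> e = \<omega> e" if "e \<notin> inner_idx (insert v S)" for \<omega> e
    proof -
      have "e \<noteq> Inr (u, v)" "e \<noteq> Inr (v, u)" "e \<notin> inner_idx S"
        using that uv by (auto simp: inner_idx_def)
      then show ?thesis by (simp add: T'_def w_def T_eq)
    qed
    moreover have "recursive_on (insert v S) (T' \<omega>)" for \<omega>
    proof -
      have w_rec: "recursive_on S (w \<omega>)" by (simp add: w_def T_rec)
      \<comment> \<open>\<open>T'\<close> alters \<open>w\<close> only on an arc leaving
        \<open>v\<close>, and messages at sites of \<open>S\<close> do not read such arcs.\<close>
      have msg_S: "message (T' \<omega>) i j = message (w \<omega>) i j" if "i \<in> S" for i j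
        by (rule message_cong) (use that uv in \<open>auto simp: T'_def\<close>)
      \<comment> \<open>This message reads the arcs from \<open>v\<close> to its neighbours other
        than \<open>u\<close>; none of them has been overwritten.\<close>
      have msg_v: "message (T' \<omega>) v u = message \<omega> v u"
        by (rule message_cong) (use uv in \<open>auto simp: T'_def w_def T_eq\<close>)
      have uv': "u \<noteq> v" using uv by auto
      have w_uv: "T' \<omega> (Inr (u, v)) = message \<omega> v u"
        using uv uv' by (auto simp: T'_def w_def T_eq)
      show ?thesis unfolding recursive_on_def
      proof (intro ballI impI)
        fix i j assume ij: "i \<in> insert v S" "j \<in> insert v S" "adj i j"
        then consider "i \<in> S" "j \<in> S" | "i = v" "j = u" | "i = u" "j = v"
          using u_only adj_irrefl by blast
        then show "T' \<omega> (Inr (j, i)) = message (T' \<omega>) i j"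
        proof cases
          case 1
          then have "T' \<omega> (Inr (j, i)) = w \<omega> (Inr (j, i))" using uv by (auto simp: T'_def)
          then show ?thesis using 1 w_rec ij msg_S by (simp add: recursive_on_def)
        next
          case 2
          then show ?thesis using w_uv msg_v by simp
        next
          case 3
          then show ?thesis using msg_S uv by (simp add: T'_def)
        qed
      qed
    qed
    ultimately show ?case by blast
  qed
qed

text \<open>The arc \<open>(u, v)\<close> into a new leaf is free for \<open>S\<close> but not for
  \<open>insert v S\<close>. Agreement there is first derived from the recursion at
  \<open>v\<close>; then the induction hypothesis gives \<open>S\<close>, and the recursion at
  \<open>u\<close> gives \<open>(v, u)\<close>.\<close>

lemma recursive_on_unique:
  assumes "finite S" "connected_set adj S" "S \<noteq> {}"
    and "recursive_on S \<omega>" "recursive_on S \<omega>'" "\<And>e. e \<in> free_idx S \<Longrightarrow> \<omega> e = \<omega>' e" "e \<in> free_idx S \<union> inner_idx S"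
  shows "\<omega> e = \<omega>' e"
proof -
  from assms(3) obtain s where s: "s \<in> S" by blast
  then have "{s} \<subseteq> S" "{s} \<noteq> {}" by auto
  from assms(1,2) connected_singleton this
  have "recursive_on S \<omega> \<and> recursive_on S \<omega>' \<and> (\<forall>e\<in>free_idx S. \<omega> e = \<omega>' e) \<longrightarrow> (\<forall>e\<in>free_idx S \<union> inner_idx S. \<omega> e = \<omega>' e)"
  proof (induction rule: connected_growth_induct)
    case base
    then show ?case by (auto simp: inner_idx_def adj_irrefl)
  next
    case (step S u v)
    note uv = \<open>u \<in> S\<close> \<open>v \<notin> S\<close> \<open>adj u v\<close> adj_sym[OF \<open>adj u v\<close>]
    have u_only: "i = u" if "i \<in> S" "adj i v \<or> adj v i" for i
      using unique_nbr_in_connected[OF \<open>connected_set adj S\<close> that(1) uv(1) uv(2)] that uv adj_sym by blast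
    show ?case
    proof (intro impI, elim conjE)
      assume rec: "recursive_on (insert v S) \<omega>" "recursive_on (insert v S) \<omega>'"
        and eq: "\<forall>e\<in>free_idx (insert v S). \<omega> e = \<omega>' e"
      have "message \<omega> v u = message \<omega>' v u"
      proof (rule message_cong)
        fix k assume k: "adj v k" "k \<noteq> u"
        then have "Inr (v, k) \<in> free_idx (insert v S)" using u_only adj_irrefl by auto
        with eq show "\<omega> (Inr (v, k)) = \<omega>' (Inr (v, k))" by blast
      qed (use eq in auto)
      then have uv_eq: "\<omega> (Inr (u, v)) = \<omega>' (Inr (u, v))"
        using rec uv by (auto simp: recursive_on_def)
      have free_eq: "\<omega> e = \<omega>' e" if "e \<in> free_idx S" for e
      proof (cases e)
        case (Inl i)
        then show ?thesis using that eq by auto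
      next
        case (Inr ij)
        then obtain i j where e: "e = Inr (i, j)" by (cases ij) auto
        show ?thesis
        proof (cases "j = v")
          case True
          then have "i = u" using e that u_only by auto
          then show ?thesis using uv_eq e True by simp
        next
          case False
          then show ?thesis using e that eq by auto
        qed
      qed
      moreover have "recursive_on S \<omega>" "recursive_on S \<omega>'" using rec by (auto intro: recursive_on_subset)
      ultimately have IH: "\<forall>e\<in>free_idx S \<union> inner_idx S. \<omega> e = \<omega>' e" using step.IH by blast
      have "message \<omega> u v = message \<omega>' u v"
        by (rule message_cong) (use IH uv in \<open>auto simp: all_conj_distrib ball_Un\<close>)
      then have vu_eq: "\<omega> (Inr (v, u)) = \<omega>' (Inr (v, u))"
        using rec uv by (auto simp: recursive_on_def)
      have "\<omega> (Inr (i, j)) = \<omega>' (Inr (i, j))" if ij: "i \<in> insert v S" "j \<in> insert v S" "adj i j" for i j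
      proof -
        consider "i \<in> S" "j \<in> S" | "i = v" "j = u" | "i = u" "j = v"
          using u_only adj_irrefl ij by blast
        then show ?thesis
        proof cases
          case 1
          then have "Inr (i, j) \<in> inner_idx S" using ij by simp
          then show ?thesis using IH by blast
        qed (use uv_eq vu_eq in auto)
      qed
      with eq show "\<forall>e\<in>free_idx (insert v S) \<union> inner_idx (insert v S). \<omega> e = \<omega>' e"
        by (auto simp: inner_idx_def)
    qed
  qed
  with assms(4-) show ?thesis by blast
qed

text \<open>The measures live on all of \<open>idx\<close> so that different sets \<open>S\<close>
  can be compared under one measure; only the coordinates at \<open>S\<close> are
  prescribed.\<close>

definition good :: "('v + 'v \<times> 'v \<Rightarrow> real) measure \<Rightarrow> 'v set \<Rightarrow> bool" where
  "good Q S \<longleftrightarrow> prob_space Q \<and> sets Q = sets (real_PiM idx) \<and>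
     distr Q (real_PiM (free_idx S)) (\<lambda>\<omega>. restrict \<omega> (free_idx S)) = PiM (free_idx S) base \<and>
     (AE \<omega> in Q. recursive_on S \<omega>)"

lemma goodD:
  assumes "good Q S"
  shows "prob_space Q" "sets Q = sets (real_PiM idx)"
    "distr Q (real_PiM (free_idx S)) (\<lambda>\<omega>. restrict \<omega> (free_idx S)) = PiM (free_idx S) base"
    "AE \<omega> in Q. recursive_on S \<omega>"
  using assms by (auto simp: good_def)

lemma restrict_measurable:
  "sets Q = sets (real_PiM idx) \<Longrightarrow> J \<subseteq> idx \<Longrightarrow> (\<lambda>\<omega>. restrict \<omega> J) \<in> measurable Q (real_PiM J)"
  by (subst measurable_cong_sets[OF _ refl]) (auto intro: measurable_restrict_subset)

lemma coord_measurable: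
  "sets Q = sets (real_PiM idx) \<Longrightarrow> e \<in> idx \<Longrightarrow> (\<lambda>\<omega>. \<omega> e) \<in> borel_measurable Q"
  by (subst measurable_cong_sets[OF _ refl]) (auto intro: measurable_component_singleton)

text \<open>Used with \<open>J = idx\<close>, and with the smallest possible \<open>J\<close>, where
  the almost sure recursion becomes a property of a finite-dimensional law.\<close>

lemma recursive_on_measurable:
  assumes S: "finite S" and J: "free_idx S \<union> inner_idx S \<subseteq> J"
  shows "{\<omega> \<in> space (real_PiM J). recursive_on S \<omega>} \<in> sets (real_PiM J)"
proof -
  let ?A = "{(i, j). i \<in> S \<and> j \<in> S \<and> adj i j}"
  have J': "Inl i \<in> J" "adj i k \<Longrightarrow> Inr (i, k) \<in> J" if "i \<in> S" for i k
  proof -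
    have "Inl i \<in> free_idx S" "adj i k \<Longrightarrow> Inr (i, k) \<in> free_idx S \<union> inner_idx S" using that by auto
    then show "Inl i \<in> J" "adj i k \<Longrightarrow> Inr (i, k) \<in> J" using J by blast+
  qed
  have "?A \<subseteq> S \<times> S" by auto
  then have fin: "finite ?A" by (rule finite_subset[OF _ finite_cartesian_product[OF S S]])
  have "{\<omega> \<in> space (real_PiM J). \<omega> (Inr (j, i)) = message \<omega> i j} \<in> sets (real_PiM J)"
    if "(i, j) \<in> ?A" for i j
  proof -
    have "(\<lambda>\<omega>. message \<omega> i j) \<in> borel_measurable (real_PiM J)"
      using that by (intro message_measurable[where J=J] J') auto
    moreover have "(\<lambda>\<omega>. \<omega> (Inr (j, i))) \<in> borel_measurable (real_PiM J)"
      using that by (intro measurable_component_singleton J') (auto intro: adj_sym)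
    ultimately show ?thesis by (rule borel_measurable_eq[rotated])
  qed
  then have "{\<omega> \<in> space (real_PiM J). \<forall>p\<in>?A. \<omega> (Inr (snd p, fst p)) = message \<omega> (fst p) (snd p)} \<in> sets (real_PiM J)"
    by (intro sets.sets_Collect_finite_All fin) auto
  moreover have "recursive_on S \<omega> \<longleftrightarrow> (\<forall>p\<in>?A. \<omega> (Inr (snd p, fst p)) = message \<omega> (fst p) (snd p))" for \<omega>
    by (auto simp: recursive_on_def)
  ultimately show ?thesis by simp
qed

lemma good_marginal:
  assumes "good Q S" "J \<subseteq> free_idx S"
  shows "distr Q (real_PiM J) (\<lambda>\<omega>. restrict \<omega> J) = PiM J base"
proof -
  note Q = goodD[OF assms(1)]
  have "distr Q (real_PiM J) (\<lambda>\<omega>. restrict \<omega> J)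
      = distr (distr Q (real_PiM (free_idx S)) (\<lambda>\<omega>. restrict \<omega> (free_idx S))) (real_PiM J) (\<lambda>\<omega>. restrict \<omega> J)"
    using assms(2) restrict_measurable[OF Q(2) free_subset_idx]
    by (subst distr_distr) (auto simp: comp_def Int_absorb1 intro: measurable_restrict_subset)
  also have "\<dots> = distr (PiM (free_idx S) base) (PiM J base) (\<lambda>\<omega>. restrict \<omega> J)"
    unfolding Q(3) by (intro distr_cong) (simp_all add: sets_PiM_base)
  also have "\<dots> = PiM J base"
    using distr_PiM_reindex[of "free_idx S" base "\<lambda>e. e" J] assms(2) prob_space_base by auto
  finally show ?thesis .
qed

lemma good_coord:
  assumes "good Q S" "e \<in> free_idx S"
  shows "distr Q borel (\<lambda>\<omega>. \<omega> e) = base e"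
proof -
  note Q = goodD[OF assms(1)]
  have "distr Q borel (\<lambda>\<omega>. \<omega> e)
      = distr (distr Q (real_PiM (free_idx S)) (\<lambda>\<omega>. restrict \<omega> (free_idx S))) borel (\<lambda>\<omega>. \<omega> e)"
    using assms(2) restrict_measurable[OF Q(2) free_subset_idx]
    by (subst distr_distr) (auto simp: comp_def)
  also have "\<dots> = distr (PiM (free_idx S) base) (base e) (\<lambda>\<omega>. \<omega> e)"
    unfolding Q(3) by (intro distr_cong) (simp_all add: sets_base)
  also have "\<dots> = base e"
    using assms(2) prob_space_base by (intro distr_PiM_component)
  finally show ?thesis .
qed

lemma good_indep_vars:
  assumes "good Q S" "S \<noteq> {}"
  shows "prob_space.indep_vars Q (\<lambda>_. borel) (\<lambda>e \<omega>. \<omega> e) (free_idx S)"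
proof -
  note Q = goodD[OF assms(1)]
  interpret prob_space Q by (rule Q)
  have "(\<Pi>\<^sub>M e\<in>free_idx S. distr Q borel (\<lambda>\<omega>. \<omega> e)) = PiM (free_idx S) base"
    by (intro PiM_cong good_coord[OF assms(1)]) auto
  with Q(3) show ?thesis
    using free_nonempty[OF assms(2)] free_subset_idx
    by (subst indep_vars_iff_distr_eq_PiM') (auto intro: coord_measurable[OF Q(2)] simp: restrict_def)
qed

text \<open>Removing the leaf \<open>v\<close> turns \<open>(u, v)\<close> into an out-arc. Its
  value comes from the uniform variable at \<open>v\<close> and the two arcs leaving
  \<open>v\<close> away from \<open>u\<close>: three coordinates that are free for
  \<open>insert v T\<close> and not for \<open>T\<close>. So independence survives, and the
  fixed-point property supplies the law.\<close>

lemma good_shrink_step: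
  assumes T: "connected_set adj T" "finite T" "T \<noteq> {}" and uv: "u \<in> T" "v \<notin> T" "adj u v"
    and good: "good Q (insert v T)"
  shows "good Q T"
proof -
  note Q = goodD[OF good]
  interpret prob_space Q by (rule Q)
  have vu: "adj v u" using uv by (simp add: adj_sym)
  have u_only: "i = u" if "i \<in> T" "adj i v \<or> adj v i" for i
    using unique_nbr_in_connected[OF T(1) that(1) uv(1) uv(2)] that uv adj_sym by blast
  obtain k l where kl: "k \<noteq> l" "nbrs adj v - {u} = {k, l}" using other_nbrs[OF vu] by metis
  then have kl': "adj v k" "adj v l" "k \<noteq> u" "l \<noteq> u" by (auto simp: nbrs_def)
  have kl_out: "k \<notin> insert v T" "l \<notin> insert v T"
    using u_only kl' adj_irrefl by auto
  define a b c :: "'v + 'v \<times> 'v" where "a = Inl v" and "b = Inr (v, k)" and "c = Inr (v, l)"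
  have abc_free: "{a, b, c} \<subseteq> free_idx (insert v T)"
    using kl' kl_out by (auto simp: a_def b_def c_def)
  have abc_dist: "a \<noteq> b" "a \<noteq> c" "b \<noteq> c" using kl by (auto simp: a_def b_def c_def)
  have abc_T: "{a, b, c} \<inter> free_idx T = {}" using uv by (auto simp: a_def b_def c_def)
  define e0 :: "'v + 'v \<times> 'v" where "e0 = Inr (u, v)"
  have e0: "e0 \<in> free_idx T" using uv by (simp add: e0_def)
  have rest: "e \<in> free_idx (insert v T)" if "e \<in> free_idx T" "e \<noteq> e0" for e
  proof (cases e)
    case (Inr ij)
    then obtain i j where e: "e = Inr (i, j)" by (cases ij) auto
    then have "j \<noteq> v" using that u_only by (auto simp: e0_def)
    then show ?thesis using e that by auto
  qed (use that in auto)
  \<comment> \<open>Disjoint blocks of coordinates free for \<open>insert v T\<close>, one for each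
    coordinate free for \<open>T\<close>; functions of disjoint blocks are independent.\<close>
  define K where "K e = (if e = e0 then {a, b, c} else {e})" for e
  define Y :: "'v + 'v \<times> 'v \<Rightarrow> ('v + 'v \<times> 'v \<Rightarrow> real) \<Rightarrow> real"
    where "Y e g = (if e = e0 then phi (g b) (g c) (g a) else g e)" for e g
  define X where "X e \<omega> = Y e (restrict \<omega> (K e))" for e \<omega>
  have ind: "indep_vars (\<lambda>e. real_PiM (K e)) (\<lambda>e \<omega>. restrict (\<lambda>i. \<omega> i) (K e)) (free_idx T)"
    using abc_free abc_T rest
    by (intro indep_vars_restrict[OF good_indep_vars[OF good]])
      (auto simp: K_def disjoint_family_on_def split: if_splits)
  have Y_m: "Y e \<in> borel_measurable (real_PiM (K e))" for e
  proof (cases "e = e0")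
    case True
    have "(\<lambda>g. phi (g b) (g c) (g a)) \<in> borel_measurable (real_PiM {a, b, c})"
      by (intro phi_measurable measurable_component_singleton) auto
    then show ?thesis using True by (simp add: K_def Y_def[abs_def])
  next
    case False
    then show ?thesis by (simp add: K_def Y_def[abs_def])
  qed
  have X_ind: "indep_vars (\<lambda>_. borel) X (free_idx T)"
    unfolding X_def[abs_def] by (rule indep_vars_compose2[OF ind Y_m])
  have X_e0: "X e0 \<omega> = message \<omega> v u" for \<omega>
    by (simp add: message_eq[OF kl(2)] X_def Y_def K_def a_def b_def c_def)
  have X_other: "X e \<omega> = \<omega> e" if "e \<noteq> e0" for e \<omega>
    using that by (simp add: X_def Y_def K_def)
  \<comment> \<open>\<open>X\<close> replaces the coordinate \<open>e0\<close> by what the recursion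
    at \<open>v\<close> prescribes, and the recursion holds only almost surely.\<close>
  have AE_X: "AE \<omega> in Q. \<forall>e. X e \<omega> = \<omega> e"
    using Q(4)
  proof (rule eventually_mono)
    fix \<omega> assume "recursive_on (insert v T) \<omega>"
    then have "\<omega> e0 = message \<omega> v u"
      using uv vu by (simp add: recursive_on_def e0_def)
    then have "X e0 \<omega> = \<omega> e0" by (simp add: X_e0)
    with X_other show "\<forall>e. X e \<omega> = \<omega> e" by metis
  qed
  have X_rv: "X e \<in> borel_measurable Q" if "e \<in> free_idx T" for e
    using X_ind that by (auto simp: indep_vars_def)
  have X_law: "distr Q borel (X e) = base e" if "e \<in> free_idx T" for e
  proof (cases "e = e0")
    case True
    have "distr Q borel (X e0) = distr (distr Q (real_PiM {a, b, c}) (\<lambda>\<omega>. restrict \<omega> {a, b, c})) borel (Y e0)"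
    proof (subst distr_distr)
      show "Y e0 \<in> borel_measurable (real_PiM {a, b, c})" using Y_m[of e0] by (simp add: K_def)
      show "(\<lambda>\<omega>. restrict \<omega> {a, b, c}) \<in> measurable Q (real_PiM {a, b, c})"
        using abc_free free_subset_idx by (intro restrict_measurable[OF Q(2)]) blast
    qed (simp add: comp_def X_def[abs_def] K_def)
    also have "\<dots> = distr (PiM {a, b, c} base) borel (\<lambda>g. phi (g b) (g c) (g a))"
      by (simp add: good_marginal[OF good abc_free] Y_def[abs_def])
    also have "\<dots> = nu"
      by (intro distr_phi_PiM prob_space_base abc_dist) (simp_all add: a_def b_def c_def)
    finally show ?thesis using True by (simp add: e0_def)
  next
    case False
    then have "X e = (\<lambda>\<omega>. \<omega> e)" by (simp add: fun_eq_iff X_other)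
    then show ?thesis using good_coord[OF good rest[OF that False]] by simp
  qed
  have "distr Q (real_PiM (free_idx T)) (\<lambda>\<omega>. restrict \<omega> (free_idx T)) = distr Q (real_PiM (free_idx T)) (\<lambda>\<omega>. \<lambda>e\<in>free_idx T. X e \<omega>)"
    using AE_X X_rv restrict_measurable[OF Q(2) free_subset_idx]
    by (intro distr_cong_AE) (auto elim!: eventually_mono)
  also have "\<dots> = (\<Pi>\<^sub>M e\<in>free_idx T. distr Q borel (X e))"
    using X_ind X_rv free_nonempty[OF T(3)] by (subst (asm) indep_vars_iff_distr_eq_PiM') auto
  also have "\<dots> = PiM (free_idx T) base"
    by (intro PiM_cong X_law) auto
  finally have "distr Q (real_PiM (free_idx T)) (\<lambda>\<omega>. restrict \<omega> (free_idx T)) = PiM (free_idx T) base" .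
  moreover have "AE \<omega> in Q. recursive_on T \<omega>"
    using Q(4) by (rule eventually_mono) (auto intro: recursive_on_subset)
  ultimately show ?thesis using Q by (simp add: good_def)
qed

lemma good_subset:
  assumes "finite S" "connected_set adj S" "connected_set adj S0" "S0 \<subseteq> S" "S0 \<noteq> {}" "good Q S"
  shows "good Q S0"
proof -
  \<comment> \<open>The implication lets an induction that enlarges the set carry goodness
    downwards.\<close>
  from assms(1-5) have "good Q S \<longrightarrow> good Q S0"
    by (induction rule: connected_growth_induct) (auto intro: good_shrink_step)
  with assms(6) show ?thesis by blast
qed

text \<open>Completing independent coordinates overwrites the inner arcs alone, so the free ones
  keep their product law.\<close>

lemma good_exists:
  assumes S: "finite S" "connected_set adj S" "S \<noteq> {}"
  shows "\<exists>Q. good Q S"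
proof -
  obtain T where T: "T \<in> measurable (real_PiM idx) (real_PiM idx)"
    and T_rec: "\<And>\<omega>. recursive_on S (T \<omega>)" and T_eq: "\<And>\<omega> e. e \<notin> inner_idx S \<Longrightarrow> T \<omega> e = \<omega> e"
    using exists_completion[OF S] by blast
  let ?M = "PiM idx base"
  interpret prob_space ?M by (intro prob_space_PiM prob_space_base)
  have T' [measurable]: "T \<in> measurable ?M (real_PiM idx)"
    using T by (metis measurable_cong_sets sets_PiM_base)
  have "free_idx S \<inter> inner_idx S = {}" by (auto simp: free_idx_def inner_idx_def out_arcs_def)
  then have rT: "restrict (T \<omega>) (free_idx S) = restrict \<omega> (free_idx S)" for \<omega>
    using T_eq by (intro restrict_ext) blast
  have "distr (distr ?M (real_PiM idx) T) (real_PiM (free_idx S)) (\<lambda>\<omega>. restrict \<omega> (free_idx S))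
      = distr ?M (real_PiM (free_idx S)) (\<lambda>\<omega>. restrict \<omega> (free_idx S))"
    using free_subset_idx by (subst distr_distr) (auto simp: comp_def rT intro!: measurable_restrict_subset)
  also have "\<dots> = distr ?M (PiM (free_idx S) base) (\<lambda>\<omega>. restrict \<omega> (free_idx S))"
    by (intro distr_cong) (simp_all add: sets_PiM_base)
  also have "\<dots> = PiM (free_idx S) base"
    using distr_PiM_reindex[of idx base "\<lambda>e. e" "free_idx S"] free_subset_idx prob_space_base by auto
  finally have "good (distr ?M (real_PiM idx) T) S"
    using T_rec recursive_on_measurable[OF S(1), of idx] free_subset_idx inner_subset_idx
    by (auto simp: good_def AE_distr_iff intro!: prob_space_distr)
  then show ?thesis by blast
qed

text \<open>As the recursion has only one solution for given free data, each such law is the image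
  of the same product law under one deterministic map.\<close>

lemma good_same_law:
  assumes S: "finite S" "connected_set adj S" "S \<noteq> {}" and "good Q S" "good Q' S" and J: "J \<subseteq> free_idx S \<union> inner_idx S"
  shows "distr Q (real_PiM J) (\<lambda>\<omega>. restrict \<omega> J) = distr Q' (real_PiM J) (\<lambda>\<omega>. restrict \<omega> J)"
proof -
  obtain T where T: "T \<in> measurable (real_PiM idx) (real_PiM idx)"
    and T_rec: "\<And>\<omega>. recursive_on S (T \<omega>)" and T_eq: "\<And>\<omega> e. e \<notin> inner_idx S \<Longrightarrow> T \<omega> e = \<omega> e"
    using exists_completion[OF S] by blast
  \<comment> \<open>The filler 0 is harmless: by \<open>recursive_on_unique\<close> the completed
    values on \<open>J\<close> depend on the free data only.\<close>
  define ext :: "('v + 'v \<times> 'v \<Rightarrow> real) \<Rightarrow> 'v + 'v \<times> 'v \<Rightarrow> real"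
    where "ext g = (\<lambda>e\<in>idx. if e \<in> free_idx S then g e else 0)" for g
  define h where "h g = restrict (T (ext g)) J" for g
  have J_idx: "J \<subseteq> idx" using J free_subset_idx inner_subset_idx by blast
  have disj: "free_idx S \<inter> inner_idx S = {}" by (auto simp: free_idx_def inner_idx_def out_arcs_def)
  have "ext \<in> measurable (real_PiM (free_idx S)) (real_PiM idx)"
    unfolding ext_def[abs_def]
  proof (rule measurable_restrict)
    show "(\<lambda>g. if e \<in> free_idx S then g e else 0) \<in> borel_measurable (real_PiM (free_idx S))" for e
      by (cases "e \<in> free_idx S") simp_all
  qed
  then have h: "h \<in> measurable (real_PiM (free_idx S)) (real_PiM J)"
    unfolding h_def[abs_def]
    by (intro measurable_compose[OF measurable_compose[OF _ T] measurable_restrict_subset[OF J_idx]])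
  have factor: "restrict \<omega> J = h (restrict \<omega> (free_idx S))" if "recursive_on S \<omega>" for \<omega>
    unfolding h_def
  proof (rule restrict_ext)
    fix e assume "e \<in> J"
    show "\<omega> e = T (ext (restrict \<omega> (free_idx S))) e"
    proof (rule recursive_on_unique[OF S that T_rec])
      fix e assume "e \<in> free_idx S"
      moreover have "e \<notin> inner_idx S" "e \<in> idx" using disj free_subset_idx \<open>e \<in> free_idx S\<close> by auto
      ultimately show "\<omega> e = T (ext (restrict \<omega> (free_idx S))) e" by (simp add: T_eq ext_def)
    qed (use \<open>e \<in> J\<close> J in blast)
  qed
  have "distr R (real_PiM J) (\<lambda>\<omega>. restrict \<omega> J) = distr (PiM (free_idx S) base) (real_PiM J) h" if "good R S" for R
  proof -
    note R = goodD[OF that]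
    note rm = restrict_measurable[OF R(2) free_subset_idx]
    have "distr R (real_PiM J) (\<lambda>\<omega>. restrict \<omega> J) = distr R (real_PiM J) (\<lambda>\<omega>. h (restrict \<omega> (free_idx S)))"
      using R(4) restrict_measurable[OF R(2) J_idx] measurable_compose[OF rm h]
      by (intro distr_cong_AE) (auto elim!: eventually_mono intro: factor)
    also have "\<dots> = distr (distr R (real_PiM (free_idx S)) (\<lambda>\<omega>. restrict \<omega> (free_idx S))) (real_PiM J) h"
      using rm h by (subst distr_distr) (auto simp: comp_def)
    finally show ?thesis using R(3) by simp
  qed
  with assms(4,5) show ?thesis by simp
qed

section \<open>The global law\<close>

text \<open>Any such set will do: \<open>marginal_eq\<close> removes the dependence on the
  choice.\<close>

definition cover :: "('v + 'v \<times> 'v) set \<Rightarrow> 'v set" where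
  "cover J = (SOME S. finite S \<and> connected_set adj S \<and> S \<noteq> {} \<and> J \<subseteq> free_idx S \<union> inner_idx S)"

definition local_law :: "'v set \<Rightarrow> ('v + 'v \<times> 'v \<Rightarrow> real) measure" where
  "local_law S = (SOME Q. good Q S)"

definition marginal :: "('v + 'v \<times> 'v) set \<Rightarrow> ('v + 'v \<times> 'v \<Rightarrow> real) measure" where
  "marginal J = distr (local_law (cover J)) (real_PiM J) (\<lambda>\<omega>. restrict \<omega> J)"

lemma cover:
  assumes "finite J" "J \<subseteq> idx"
  shows "finite (cover J) \<and> connected_set adj (cover J) \<and> cover J \<noteq> {} \<and>
    J \<subseteq> free_idx (cover J) \<union> inner_idx (cover J)"
  unfolding cover_def
proof (rule someI_ex)
  \<comment> \<open>The first endpoint of an arc suffices: an arc starting in \<open>S\<close> is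
    either inner or free for \<open>S\<close>.\<close>
  have "finite (case_sum id fst ` J)" using assms(1) by simp
  then obtain S where S: "finite S" "connected_set adj S" "S \<noteq> {}" "case_sum id fst ` J \<subseteq> S"
    using finite_connected_superset by blast
  have "J \<subseteq> free_idx S \<union> inner_idx S"
  proof
    fix e assume e: "e \<in> J"
    with S(4) have "case_sum id fst e \<in> S" by blast
    moreover have "e \<in> idx" using e assms(2) by blast
    ultimately show "e \<in> free_idx S \<union> inner_idx S"
      by (cases e) auto
  qed
  with S show "\<exists>S. finite S \<and> connected_set adj S \<and> S \<noteq> {} \<and> J \<subseteq> free_idx S \<union> inner_idx S" by blast
qed

lemma local_law: "finite S \<Longrightarrow> connected_set adj S \<Longrightarrow> S \<noteq> {} \<Longrightarrow> good (local_law S) S"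
  unfolding local_law_def by (rule someI_ex) (rule good_exists)

text \<open>\<open>S\<close> and the chosen cover lie in a common finite connected set. A law good
  there is good for both, and local uniqueness identifies the marginals.\<close>

lemma marginal_eq:
  assumes "finite J" and S: "finite S" "connected_set adj S" "S \<noteq> {}" "J \<subseteq> free_idx S \<union> inner_idx S"
    and Q: "good Q S"
  shows "marginal J = distr Q (real_PiM J) (\<lambda>\<omega>. restrict \<omega> J)"
proof -
  have "J \<subseteq> idx" using S(4) free_subset_idx inner_subset_idx by blast
  note C = cover[OF assms(1) this]
  obtain S' where S': "finite S'" "connected_set adj S'" "S' \<noteq> {}" "S \<union> cover J \<subseteq> S'"
    using finite_connected_superset[of "S \<union> cover J"] S C by auto
  note L = local_law[OF S'(1-3)]
  have "good (local_law S') S" "good (local_law S') (cover J)"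
    using S S' C by (auto intro!: good_subset[OF S'(1,2) _ _ _ L])
  moreover have "good (local_law (cover J)) (cover J)" using C by (intro local_law) auto
  ultimately show ?thesis
    unfolding marginal_def using C good_same_law[OF S(1-3) Q _ S(4)]
      good_same_law[of "cover J" "local_law (cover J)" "local_law S'" J] by metis
qed

text \<open>The cover of \<open>H\<close> also covers \<open>J\<close>, so both marginals can be
  read off one local law.\<close>

lemma polish_projective_marginal: "polish_projective idx marginal"
proof (intro polish_projective.intro projective_family.intro)
  fix J H assume JH: "J \<subseteq> H" "finite H" "H \<subseteq> idx"
  note C = cover[OF JH(2,3)]
  have L: "good (local_law (cover H)) (cover H)" using C by (intro local_law) auto
  have "marginal J = distr (local_law (cover H)) (real_PiM J) (\<lambda>\<omega>. restrict \<omega> J)"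
    using JH C by (intro marginal_eq[OF _ _ _ _ _ L]) (auto intro: finite_subset)
  also have "\<dots> = distr (marginal H) (real_PiM J) (\<lambda>\<omega>. restrict \<omega> J)"
    unfolding marginal_def using JH restrict_measurable[OF goodD(2)[OF L] JH(3)]
    by (subst distr_distr) (auto simp: comp_def Int_absorb1 intro: measurable_restrict_subset)
  finally show "marginal J = distr (marginal H) (real_PiM J) (\<lambda>\<omega>. restrict \<omega> J)" .
next
  fix J assume J: "finite J" "J \<subseteq> idx"
  note C = cover[OF J]
  have L: "good (local_law (cover J)) (cover J)" using C by (intro local_law) auto
  show "prob_space (marginal J)"
    unfolding marginal_def
    by (intro prob_space.prob_space_distr goodD(1)[OF L] restrict_measurable[OF goodD(2)[OF L] J(2)])
qed

text \<open>Goodness for \<open>S\<close> concerns finitely many coordinates, so the projective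
  limit inherits it from its marginals.\<close>

lemma good_everywhere_exists:
  "\<exists>Q. \<forall>S. finite S \<longrightarrow> connected_set adj S \<longrightarrow> S \<noteq> {} \<longrightarrow> good Q S"
proof -
  interpret polish_projective idx marginal by (rule polish_projective_marginal)
  have sets_lim': "sets lim = sets (real_PiM idx)" by simp
  have lim_J: "distr lim (real_PiM J) (\<lambda>\<omega>. restrict \<omega> J) = marginal J" if J: "finite J" "J \<subseteq> idx" for J
  proof (rule measure_eqI)
    show "sets (distr lim (real_PiM J) (\<lambda>\<omega>. restrict \<omega> J)) = sets (marginal J)"
      by (simp add: marginal_def)
    fix A assume "A \<in> sets (distr lim (real_PiM J) (\<lambda>\<omega>. restrict \<omega> J))"
    then have A: "A \<in> sets (real_PiM J)" by simp
    have "emeasure (distr lim (real_PiM J) (\<lambda>\<omega>. restrict \<omega> J)) A = emeasure lim (prod_emb idx (\<lambda>_. borel) J A)"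
      using A J restrict_measurable[OF sets_lim' J(2)]
      by (subst emeasure_distr) (auto simp: prod_emb_def space_PiM)
    also have "\<dots> = emeasure (marginal J) A"
      using emeasure_lim_emb[OF J(2,1) A] .
    finally show "emeasure (distr lim (real_PiM J) (\<lambda>\<omega>. restrict \<omega> J)) A = emeasure (marginal J) A" .
  qed
  have "good lim S" if S: "finite S" "connected_set adj S" "S \<noteq> {}" for S
  proof -
    let ?D = "free_idx S \<union> inner_idx S"
    note L = local_law[OF S]
    have "inner_idx S \<subseteq> Inr ` (S \<times> S)" by (auto simp: inner_idx_def)
    then have fin: "finite ?D" using S finite_free by (auto intro: finite_subset)
    have D_idx: "?D \<subseteq> idx" using free_subset_idx inner_subset_idx by blast
    have same: "distr lim (real_PiM J) (\<lambda>\<omega>. restrict \<omega> J) = distr (local_law S) (real_PiM J) (\<lambda>\<omega>. restrict \<omega> J)"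
      if "J \<subseteq> ?D" for J
    proof -
      have "finite J" "J \<subseteq> idx" using that fin D_idx by (auto intro: finite_subset)
      then show ?thesis using lim_J marginal_eq[OF _ S that L] by simp
    qed
    have rec: "recursive_on S (restrict \<omega> ?D) = recursive_on S \<omega>" for \<omega>
    proof -
      have "message (restrict \<omega> ?D) i j = message \<omega> i j" if "i \<in> S" for i j
        by (rule message_cong) (use that in auto)
      then show ?thesis using adj_sym by (auto simp: recursive_on_def)
    qed
    \<comment> \<open>The recursion on \<open>S\<close> reads coordinates in \<open>?D\<close> only,
      so its almost sure validity is decided by the marginal on \<open>?D\<close>.\<close>
    have AE_iff: "(AE \<omega> in Q. recursive_on S \<omega>) \<longleftrightarrow>
        (AE g in distr Q (real_PiM ?D) (\<lambda>\<omega>. restrict \<omega> ?D). recursive_on S g)"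
      if "sets Q = sets (real_PiM idx)" for Q
      using AE_distr_iff[OF restrict_measurable[OF that D_idx] recursive_on_measurable[OF S(1) order_refl]]
      by (simp add: rec)
    have "AE \<omega> in lim. recursive_on S \<omega>"
      using AE_iff[OF sets_lim'] AE_iff[OF goodD(2)[OF L]] goodD(4)[OF L] same[OF order_refl] by metis
    moreover have "distr lim (real_PiM (free_idx S)) (\<lambda>\<omega>. restrict \<omega> (free_idx S)) = PiM (free_idx S) base"
      using same[of "free_idx S"] goodD(3)[OF L] by simp
    ultimately show ?thesis
      using P.prob_space_axioms by (simp add: good_def)
  qed
  then show ?thesis by blast
qed

text \<open>Finite cylinders determine the measure, and each involves only coordinates at some
  finite connected set, where the law is unique.\<close>

lemma good_everywhere_unique:
  assumes "\<And>S. finite S \<Longrightarrow> connected_set adj S \<Longrightarrow> S \<noteq> {} \<Longrightarrow> good Q S"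
    and "\<And>S. finite S \<Longrightarrow> connected_set adj S \<Longrightarrow> S \<noteq> {} \<Longrightarrow> good Q' S"
  shows "Q = Q'"
proof -
  \<comment> \<open>\<open>undefined\<close> is an arbitrary site; it supplies total mass one and
    the sigma-algebra.\<close>
  have g: "good Q {undefined}" "good Q' {undefined}"
    using assms connected_singleton by auto
  note Q = goodD[OF g(1)] and Q' = goodD[OF g(2)]
  interpret Q: prob_space Q by (rule Q)
  show ?thesis
  proof (rule measure_eqI_PiM_infinite[where I=idx and M="\<lambda>_. borel"])
    fix A :: "'v + 'v \<times> 'v \<Rightarrow> real set" and J
    assume J: "finite J" "J \<subseteq> idx" and A: "\<And>i. i \<in> J \<Longrightarrow> A i \<in> sets borel"
    note C = cover[OF J]
    have A': "Pi\<^sub>E J A \<in> sets (real_PiM J)" using J A by (intro sets_PiM_I_finite) auto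
    have emb: "emeasure R (prod_emb idx (\<lambda>_. borel) J (Pi\<^sub>E J A))
        = emeasure (distr R (real_PiM J) (\<lambda>\<omega>. restrict \<omega> J)) (Pi\<^sub>E J A)"
      if "sets R = sets (real_PiM idx)" for R
      using A' restrict_measurable[OF that J(2)] sets_eq_imp_space_eq[OF that]
      by (subst emeasure_distr) (auto simp: prod_emb_def space_PiM)
    show "emeasure Q (prod_emb idx (\<lambda>_. borel) J (Pi\<^sub>E J A)) = emeasure Q' (prod_emb idx (\<lambda>_. borel) J (Pi\<^sub>E J A))"
      unfolding emb[OF Q(2)] emb[OF Q'(2)] using C assms
      by (subst good_same_law[of "cover J" Q Q']) auto
  qed (use Q Q' Q.finite_measure_axioms in auto)
qed

section \<open>Automorphisms acting on coordinates\<close>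

definition relabel_idx :: "('v \<Rightarrow> 'v) \<Rightarrow> 'v + 'v \<times> 'v \<Rightarrow> 'v + 'v \<times> 'v" where
  "relabel_idx \<phi> = map_sum \<phi> (map_prod \<phi> \<phi>)"

definition relabel_coords :: "('v \<Rightarrow> 'v) \<Rightarrow> ('v + 'v \<times> 'v \<Rightarrow> real) \<Rightarrow> 'v + 'v \<times> 'v \<Rightarrow> real" where
  "relabel_coords \<phi> \<omega> = (\<lambda>e\<in>idx. \<omega> (relabel_idx \<phi> e))"

lemma relabel_idx_simps [simp]:
  "relabel_idx \<phi> (Inl i) = Inl (\<phi> i)" "relabel_idx \<phi> (Inr (i, j)) = Inr (\<phi> i, \<phi> j)"
  by (simp_all add: relabel_idx_def)

lemma base_relabel_idx: "base (relabel_idx \<phi> e) = base e"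
  by (cases e) (simp_all add: relabel_idx_def)

lemma connected_image:
  assumes "automorphism adj \<phi>" "connected_set adj S"
  shows "connected_set adj (\<phi> ` S)"
  unfolding connected_set_def
proof (safe)
  fix x y assume xy: "x \<in> S" "y \<in> S"
  then have "(\<lambda>a b. a \<in> S \<and> b \<in> S \<and> adj a b)\<^sup>*\<^sup>* x y"
    using assms(2) by (auto simp: connected_set_def)
  then show "(\<lambda>a b. a \<in> \<phi> ` S \<and> b \<in> \<phi> ` S \<and> adj a b)\<^sup>*\<^sup>* (\<phi> x) (\<phi> y)"
  proof (induction rule: rtranclp_induct)
    case (step y z)
    then have "\<phi> y \<in> \<phi> ` S \<and> \<phi> z \<in> \<phi> ` S \<and> adj (\<phi> y) (\<phi> z)"
      using assms(1) by (auto simp: automorphism_def)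
    with step.IH show ?case by (rule rtranclp.rtrancl_into_rtrancl)
  qed simp
qed

lemma relabel_idx_in_idx:
  assumes "automorphism adj \<phi>" "e \<in> idx"
  shows "relabel_idx \<phi> e \<in> idx"
  using assms by (cases e) (auto simp: automorphism_def)

lemma relabel_coords_measurable:
  assumes "automorphism adj \<phi>"
  shows "relabel_coords \<phi> \<in> measurable (real_PiM idx) (real_PiM idx)"
  unfolding relabel_coords_def[abs_def]
  by (intro measurable_restrict measurable_component_singleton relabel_idx_in_idx[OF assms])

text \<open>Coordinate \<open>e\<close> of the relabelled family is coordinate
  \<open>relabel_idx \<phi> e\<close> of the original, so what is required at \<open>S\<close> is
  what is known at the image of \<open>S\<close>.\<close>

lemma good_relabel:
  assumes \<phi>: "automorphism adj \<phi>" and S: "finite S" and good: "good Q (\<phi> ` S)"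
  shows "good (distr Q (real_PiM idx) (relabel_coords \<phi>)) S"
proof -
  note Q = goodD[OF good]
  interpret prob_space Q by (rule Q)
  have bij: "bij \<phi>" and adj_iff: "\<And>i j. adj (\<phi> i) (\<phi> j) \<longleftrightarrow> adj i j"
    using \<phi> by (auto simp: automorphism_def)
  have inj: "\<phi> i = \<phi> j \<longleftrightarrow> i = j" for i j using bij by (metis bij_is_inj injD)
  have mem: "\<phi> i \<in> \<phi> ` S \<longleftrightarrow> i \<in> S" for i S using bij by (simp add: bij_is_inj inj_image_mem_iff)
  have R: "relabel_coords \<phi> \<in> measurable Q (real_PiM idx)"
    using relabel_coords_measurable[OF \<phi>] Q(2) by (metis measurable_cong_sets)
  have free_R: "relabel_idx \<phi> e \<in> free_idx (\<phi> ` S)" if "e \<in> free_idx S" for e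
    using that by (cases e) (auto simp: mem adj_iff)
  have inj_R: "inj_on (relabel_idx \<phi>) A" for A
    using bij unfolding relabel_idx_def
    by (auto intro!: inj_on_subset[OF sum.inj_map] prod.inj_map simp: bij_is_inj)
  let ?r = "\<lambda>g. \<lambda>e\<in>free_idx S. g (relabel_idx \<phi> e)"
  have r_m: "?r \<in> measurable (real_PiM (free_idx (\<phi> ` S))) (real_PiM (free_idx S))"
    using free_R by (intro measurable_restrict measurable_component_singleton) auto
  have "distr (distr Q (real_PiM idx) (relabel_coords \<phi>)) (real_PiM (free_idx S)) (\<lambda>\<omega>. restrict \<omega> (free_idx S))
      = distr Q (real_PiM (free_idx S)) (\<lambda>\<omega>. ?r (restrict \<omega> (free_idx (\<phi> ` S))))"
  proof (subst distr_distr[OF measurable_restrict_subset[OF free_subset_idx] R], rule distr_cong)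
    fix \<omega>
    show "((\<lambda>\<omega>. restrict \<omega> (free_idx S)) \<circ> relabel_coords \<phi>) \<omega> = ?r (restrict \<omega> (free_idx (\<phi> ` S)))"
      using free_R free_subset_idx by (auto simp: relabel_coords_def fun_eq_iff restrict_def)
  qed auto
  also have "\<dots> = distr (distr Q (real_PiM (free_idx (\<phi> ` S))) (\<lambda>\<omega>. restrict \<omega> (free_idx (\<phi> ` S)))) (real_PiM (free_idx S)) ?r"
    by (subst distr_distr[OF r_m restrict_measurable[OF Q(2) free_subset_idx]]) (simp add: comp_def)
  also have "\<dots> = distr (PiM (free_idx (\<phi> ` S)) base) (\<Pi>\<^sub>M e\<in>free_idx S. base (relabel_idx \<phi> e)) ?r"
    unfolding Q(3) by (intro distr_cong) (simp_all add: base_relabel_idx sets_PiM_base)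
  also have "\<dots> = PiM (free_idx S) base"
    using free_R by (subst distr_PiM_reindex) (auto simp: prob_space_base inj_R base_relabel_idx)
  finally have "distr (distr Q (real_PiM idx) (relabel_coords \<phi>)) (real_PiM (free_idx S)) (\<lambda>\<omega>. restrict \<omega> (free_idx S))
      = PiM (free_idx S) base" .
  moreover have "AE \<omega> in distr Q (real_PiM idx) (relabel_coords \<phi>). recursive_on S \<omega>"
  proof (subst AE_distr_iff[OF R])
    show "{\<omega> \<in> space (real_PiM idx). recursive_on S \<omega>} \<in> sets (real_PiM idx)"
      using free_subset_idx inner_subset_idx by (intro recursive_on_measurable S) auto
    show "AE \<omega> in Q. recursive_on S (relabel_coords \<phi> \<omega>)"
      using Q(4)
    proof (rule eventually_mono)
      fix \<omega> assume rec: "recursive_on (\<phi> ` S) \<omega>"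
      \<comment> \<open>Minimum and maximum over the set of neighbours commute with a bijection of
        neighbours; no order has to be transported.\<close>
      have msg: "message (relabel_coords \<phi> \<omega>) i j = message \<omega> (\<phi> i) (\<phi> j)" for i j
      proof -
        have "nbrs adj (\<phi> i) - {\<phi> j} = \<phi> ` (nbrs adj i - {j})"
        proof (intro equalityI subsetI)
          fix k assume k: "k \<in> nbrs adj (\<phi> i) - {\<phi> j}"
          obtain k' where "k = \<phi> k'" using bij by (metis bij_pointE)
          with k show "k \<in> \<phi> ` (nbrs adj i - {j})" by (auto simp: nbrs_def adj_iff)
        qed (auto simp: nbrs_def adj_iff inj)
        then have "(\<lambda>k. \<omega> (Inr (\<phi> i, k))) ` (nbrs adj (\<phi> i) - {\<phi> j})
            = (\<lambda>k. relabel_coords \<phi> \<omega> (Inr (i, k))) ` (nbrs adj i - {j})"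
          by (auto simp: image_image relabel_coords_def nbrs_def intro!: image_cong)
        then show ?thesis unfolding message_def by (simp add: relabel_coords_def)
      qed
      show "recursive_on S (relabel_coords \<phi> \<omega>)"
        unfolding recursive_on_def
      proof (intro ballI impI)
        fix i j assume ij: "i \<in> S" "j \<in> S" "adj i j"
        then have "\<omega> (Inr (\<phi> j, \<phi> i)) = message \<omega> (\<phi> i) (\<phi> j)"
          using rec by (auto simp: recursive_on_def adj_iff)
        then show "relabel_coords \<phi> \<omega> (Inr (j, i)) = message (relabel_coords \<phi> \<omega>) i j"
          unfolding msg using adj_sym[OF ij(3)] by (simp add: relabel_coords_def)
      qed
    qed
  qed
  ultimately show ?thesis using prob_space_distr[OF R] by (simp add: good_def)
qed

lemma good_everywhere_invariant:
  assumes Q: "\<And>S. finite S \<Longrightarrow> connected_set adj S \<Longrightarrow> S \<noteq> {} \<Longrightarrow> good Q S" and \<phi>: "automorphism adj \<phi>"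
  shows "distr Q (real_PiM idx) (relabel_coords \<phi>) = Q"
  by (rule good_everywhere_unique)
    (auto intro!: good_relabel[OF \<phi>] Q connected_image[OF \<phi>])

end

section \<open>Transfer to the configuration space\<close>

text \<open>Injectivity makes the singletons \<open>{f i}\<close> disjoint blocks of the independent
  family.\<close>

lemma (in prob_space) indep_vars_reindex:
  assumes "indep_vars M' X I" "inj_on f K" "f ` K \<subseteq> I"
  shows "indep_vars (\<lambda>i. M' (f i)) (\<lambda>i. X (f i)) K"
proof -
  have "indep_vars (\<lambda>i. PiM {f i} M') (\<lambda>i \<omega>. restrict (\<lambda>j. X j \<omega>) {f i}) K"
    using assms by (intro indep_vars_restrict[OF assms(1)]) (auto simp: disjoint_family_on_def inj_on_def)
  then have "indep_vars (\<lambda>i. M' (f i)) (\<lambda>i \<omega>. restrict (\<lambda>j. X j \<omega>) {f i} (f i)) K"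
    by (rule indep_vars_compose2[where Y="\<lambda>i g. g (f i)"]) simp
  then show ?thesis by simp
qed

lemma (in prob_space) indep_vars_distr:
  assumes E: "E \<in> measurable M N" and X: "\<And>i. i \<in> I \<Longrightarrow> X i \<in> measurable N (M' i)"
    and ind: "indep_vars M' (\<lambda>i \<omega>. X i (E \<omega>)) I"
  shows "prob_space.indep_vars (distr M N E) M' X I"
proof -
  interpret D: prob_space "distr M N E" by (rule prob_space_distr[OF E])
  show ?thesis
    unfolding D.indep_vars_def2
  proof (intro conjI ballI D.indep_setsI)
    fix i assume i: "i \<in> I"
    then show "X i \<in> measurable (distr M N E) (M' i)" using X by simp
    show "{X i -` A \<inter> space (distr M N E) |A. A \<in> sets (M' i)} \<subseteq> D.events"
      using X[OF i] by (auto intro: measurable_sets)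
  next
    fix A J assume J: "J \<noteq> {}" "J \<subseteq> I" "finite J"
      and A: "\<forall>j\<in>J. A j \<in> {X j -` B \<inter> space (distr M N E) |B. B \<in> sets (M' j)}"
    then have "\<forall>j\<in>J. \<exists>B. B \<in> sets (M' j) \<and> A j = X j -` B \<inter> space N" by auto
    then obtain B where B: "\<And>j. j \<in> J \<Longrightarrow> B j \<in> sets (M' j)" "\<And>j. j \<in> J \<Longrightarrow> A j = X j -` B j \<inter> space N"
      by metis
    have A_sets: "A j \<in> sets N" if "j \<in> J" for j
      using B[OF that] X that J by (auto intro: measurable_sets)
    have pre: "E -` A j \<inter> space M = (\<lambda>\<omega>. X j (E \<omega>)) -` B j \<inter> space M" if "j \<in> J" for j
      using B(2)[OF that] measurable_space[OF E] by auto
    have "D.prob (\<Inter>j\<in>J. A j) = prob (E -` (\<Inter>j\<in>J. A j) \<inter> space M)"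
      using J A_sets by (intro measure_distr[OF E] sets.finite_INT) auto
    also have "E -` (\<Inter>j\<in>J. A j) \<inter> space M = (\<Inter>j\<in>J. (\<lambda>\<omega>. X j (E \<omega>)) -` B j \<inter> space M)"
      using pre J(1) by blast
    also have "prob \<dots> = (\<Prod>j\<in>J. prob ((\<lambda>\<omega>. X j (E \<omega>)) -` B j \<inter> space M))"
      using J B(1) by (intro indep_varsD[OF ind]) auto
    also have "\<dots> = (\<Prod>j\<in>J. D.prob (A j))"
      using A_sets pre by (intro prod.cong) (simp_all add: measure_distr[OF E])
    finally show "D.prob (\<Inter>j\<in>J. A j) = (\<Prod>j\<in>J. D.prob (A j))" .
  qed
qed

text \<open>The truncations in \<open>decode\<close> and \<open>clamp01\<close> only act on null sets; they make the decoded
  values lie in \<open>I\<close> and \<open>[0,1]\<close> everywhere.\<close>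

definition decode :: "real \<Rightarrow> ereal" where
  "decode t = (if t \<le> 1 then ereal (max (1/2) t) else \<infinity>)"

definition clamp01 :: "real \<Rightarrow> real" where
  "clamp01 u = max 0 (min 1 u)"

lemma decode_measurable [measurable]: "decode \<in> borel_measurable borel"
  unfolding decode_def by measurable

lemma clamp01_measurable [measurable]: "clamp01 \<in> borel_measurable borel"
  unfolding clamp01_def by measurable

lemma decode_in_I_set: "decode t \<in> I_set"
  by (simp add: decode_def I_set_def max_def)

lemma clamp01_in: "clamp01 u \<in> {0..1}"
  by (simp add: clamp01_def)

lemma clamp01_id: "u \<in> {0..1} \<Longrightarrow> clamp01 u = u"
  by (simp add: clamp01_def)

text \<open>\<open>decode\<close> preserves the order on \<open>coded_I\<close>, and against
  \<open>u\<close> in [0,1] the code 2 behaves like infinity: it is always accepted.\<close>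

lemma decode_phi:
  assumes "x \<in> coded_I" "y \<in> coded_I" "u \<in> {0..1}"
  shows "decode (phi x y u) = Phi (min (decode x) (decode y)) (max (decode x) (decode y)) u"
  using assms by (auto simp: decode_def phi_def Phi_def coded_I_def min_def max_def)

lemma measure_nu_decode_le: "measure nu {x. decode x \<le> t} = F_dist t"
proof -
  interpret prob_space nu by (rule prob_space_nu)
  have cdf: "measure nu {..r} = ln (2 * r)" if "r \<in> {1/2..1}" for r
    using emeasure_nu_atMost[OF that] that by (simp add: measure_def)
  consider "t \<le> ereal (1/2)" | "ereal (1/2) < t" "t \<le> ereal 1" | "ereal 1 < t" "t < \<infinity>" | "t = \<infinity>"
    by force
  then show ?thesis
  proof cases
    case 1
    \<comment> \<open>Truncation sends everything below 1/2 to 1/2, but that part has mass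
      \<open>ln 1\<close>, which is 0.\<close>
    have "{x. decode x \<le> t} \<subseteq> {..1/2}"
    proof
      fix x assume "x \<in> {x. decode x \<le> t}"
      then have "decode x \<le> ereal (1/2)" using 1 by (auto intro: order_trans)
      then show "x \<in> {..1/2}" by (auto simp: decode_def split: if_splits)
    qed
    then have "measure nu {x. decode x \<le> t} \<le> measure nu {..1/2}"
      by (intro finite_measure_mono) auto
    then have "measure nu {x. decode x \<le> t} = 0"
      using cdf[of "1/2"] by (simp add: measure_le_0_iff)
    then show ?thesis using 1 by (simp add: F_dist_def)
  next
    case 2
    then obtain r where r: "t = ereal r" by (cases t) auto
    then have "{x. decode x \<le> t} = {..r}" using 2 by (auto simp: decode_def)
    then show ?thesis using 2 r cdf[of r] by (simp add: F_dist_def)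
  next
    case 3
    then obtain r where r: "t = ereal r" by (cases t) auto
    then have "{x. decode x \<le> t} = {..1}" using 3 by (auto simp: decode_def)
    then show ?thesis using 3 r cdf[of 1] by (simp add: F_dist_def)
  next
    case 4
    then show ?thesis using prob_space by (simp add: F_dist_def)
  qed
qed

section \<open>Configurations built from real coordinates\<close>

context bethe_lattice
begin

definition to_config :: "('v + 'v \<times> 'v \<Rightarrow> real) \<Rightarrow> 'v config" where
  "to_config \<omega> = (\<lambda>i. clamp01 (\<omega> (Inl i)), \<lambda>e\<in>arcs adj. decode (\<omega> (Inr e)))"

lemma to_config_vars [simp]:
  "U_var i (to_config \<omega>) = clamp01 (\<omega> (Inl i))"
  "adj i j \<Longrightarrow> Y_var i j (to_config \<omega>) = decode (\<omega> (Inr (i, j)))"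
  by (simp_all add: to_config_def U_var_def Y_var_def arcs_def nbrs_def)

lemma to_config_measurable [measurable]: "to_config \<in> measurable (real_PiM idx) (config_space adj)"
  unfolding config_space_def
proof (rule measurable_pair)
  have "(\<lambda>\<omega>. \<lambda>i\<in>UNIV. clamp01 (\<omega> (Inl i))) \<in> measurable (real_PiM idx) (\<Pi>\<^sub>M i\<in>UNIV. restrict_space borel {0..1})"
    by (intro measurable_restrict measurable_restrict_space2) (use clamp01_in in \<open>auto\<close>)
  then show "fst \<circ> to_config \<in> measurable (real_PiM idx) (\<Pi>\<^sub>M i\<in>UNIV. restrict_space borel {0..1})"
    by (simp add: to_config_def comp_def restrict_UNIV)
  have "(\<lambda>\<omega>. \<lambda>e\<in>arcs adj. decode (\<omega> (Inr e))) \<in> measurable (real_PiM idx) (\<Pi>\<^sub>M e\<in>arcs adj. restrict_space borel I_set)"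
    by (intro measurable_restrict measurable_restrict_space2) (use decode_in_I_set in \<open>auto simp: idx_def\<close>)
  then show "snd \<circ> to_config \<in> measurable (real_PiM idx) (\<Pi>\<^sub>M e\<in>arcs adj. restrict_space borel I_set)"
    by (simp add: to_config_def comp_def restrict_UNIV)
qed

lemma U_var_measurable_restrict: "U_var i \<in> measurable (config_space adj) (restrict_space borel {0..1})"
  unfolding config_space_def U_var_def[abs_def] by measurable

lemma Y_var_measurable_restrict:
  "adj i j \<Longrightarrow> Y_var i j \<in> measurable (config_space adj) (restrict_space borel I_set)"
  unfolding config_space_def Y_var_def[abs_def]
  by (rule measurable_compose[OF measurable_snd measurable_component_singleton])
    (simp add: arcs_def nbrs_def)

lemma U_var_measurable: "U_var i \<in> borel_measurable (config_space adj)"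
  using U_var_measurable_restrict by (auto simp: measurable_restrict_space2_iff)

lemma Y_var_measurable: "adj i j \<Longrightarrow> Y_var i j \<in> borel_measurable (config_space adj)"
  using Y_var_measurable_restrict by (auto simp: measurable_restrict_space2_iff)

lemma relabel_measurable:
  assumes "automorphism adj \<phi>"
  shows "relabel adj \<phi> \<in> measurable (config_space adj) (config_space adj)"
proof -
  have "(\<lambda>\<omega>. \<lambda>i\<in>UNIV. U_var (\<phi> i) \<omega>) \<in> measurable (config_space adj) (\<Pi>\<^sub>M i\<in>UNIV. restrict_space borel {0..1})"
    by (intro measurable_restrict U_var_measurable_restrict)
  moreover have "(\<lambda>\<omega>. \<lambda>e\<in>arcs adj. (case e of (i, j) \<Rightarrow> Y_var (\<phi> i) (\<phi> j) \<omega>))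
      \<in> measurable (config_space adj) (\<Pi>\<^sub>M e\<in>arcs adj. restrict_space borel I_set)"
    by (intro measurable_restrict)
      (use assms in \<open>auto simp: arcs_def nbrs_def automorphism_def intro!: Y_var_measurable_restrict\<close>)
  ultimately show ?thesis
    unfolding relabel_def[abs_def]
    by (subst (2) config_space_def) (intro measurable_Pair, simp_all add: restrict_UNIV)
qed

lemma relabel_to_config:
  assumes "automorphism adj \<phi>"
  shows "relabel adj \<phi> (to_config \<omega>) = to_config (relabel_coords \<phi> \<omega>)"
proof -
  have adj_iff: "adj (\<phi> i) (\<phi> j) \<longleftrightarrow> adj i j" for i j using assms by (auto simp: automorphism_def)
  have "(\<lambda>(i, j)\<in>arcs adj. Y_var (\<phi> i) (\<phi> j) (to_config \<omega>))
      = (\<lambda>e\<in>arcs adj. decode (relabel_coords \<phi> \<omega> (Inr e)))"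
  proof (rule restrict_ext)
    fix e assume "e \<in> arcs adj"
    then obtain i j where e: "e = (i, j)" "adj i j" by (auto simp: arcs_def nbrs_def)
    then show "(case e of (i, j) \<Rightarrow> Y_var (\<phi> i) (\<phi> j) (to_config \<omega>)) = decode (relabel_coords \<phi> \<omega> (Inr e))"
      by (simp add: adj_iff relabel_coords_def)
  qed
  then show ?thesis
    by (simp add: relabel_def to_config_def[of "relabel_coords \<phi> \<omega>"]) (simp add: relabel_coords_def)
qed

end

theorem lemma4p1:
  fixes adj :: "'v \<Rightarrow> 'v \<Rightarrow> bool"
  assumes tree: "three_regular_tree adj"
  shows "\<exists>P :: 'v config measure.
    prob_space P \<and> sets P = sets (config_space adj) \<and>
    prob_space.indep_vars P (\<lambda>_. borel) U_var UNIV \<and>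
    (\<forall>i. distr P borel (U_var i) = uniform_measure lborel {0..1}) \<and>
    automorphism_invariant adj P \<and>
    (\<forall>i. \<forall>j\<in>nbrs adj i.
       has_distribution_function P (Y_var j i) F_dist \<and>
       (\<forall>k l. {k, l} = nbrs adj i - {j} \<longrightarrow>
          (AE \<omega> in P. Y_var j i \<omega> =
             Phi (min (Y_var i k \<omega>) (Y_var i l \<omega>))
                 (max (Y_var i k \<omega>) (Y_var i l \<omega>)) (U_var i \<omega>)))) \<and>
    (\<forall>S. finite S \<and> connected_set adj S \<longrightarrow>
       prob_space.indep_vars P (\<lambda>_. borel) (\<lambda>(i, j). Y_var i j) (out_arcs adj S) \<and>
       indep_pair P
         (\<Pi>\<^sub>M e\<in>out_arcs adj S. borel) (\<lambda>\<omega>. \<lambda>(i, j)\<in>out_arcs adj S. Y_var i j \<omega>)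
         (\<Pi>\<^sub>M i\<in>S. borel) (\<lambda>\<omega>. \<lambda>i\<in>S. U_var i \<omega>))"
proof -
  interpret bethe_lattice adj by unfold_locales (rule tree)
  obtain Q where good: "\<And>S. finite S \<Longrightarrow> connected_set adj S \<Longrightarrow> S \<noteq> {} \<Longrightarrow> good Q S"
    using good_everywhere_exists by blast
  have good1: "good Q {i}" for i by (rule good) (simp_all add: connected_singleton)
  note Q = goodD(1,2)[OF good1]
  interpret Q: prob_space Q by (rule Q)
  have coord: "(\<lambda>\<omega>. \<omega> e) \<in> borel_measurable Q" if "e \<in> idx" for e
    using coord_measurable[OF Q(2) that] .
  have E [measurable]: "to_config \<in> measurable Q (config_space adj)"
    using to_config_measurable Q(2) by (simp cong: measurable_cong_sets)
  define P where "P = distr Q (config_space adj) to_config"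
  interpret P: prob_space P unfolding P_def by (rule Q.prob_space_distr[OF E])
  have sets_P [measurable_cong]: "sets P = sets (config_space adj)" by (simp add: P_def)
  have U_P: "U_var i \<in> borel_measurable P" for i
    using U_var_measurable by (simp add: P_def)
  have Y_P: "Y_var i j \<in> borel_measurable P" if "adj i j" for i j
    using Y_var_measurable[OF that] by (simp add: P_def)
  have law_U: "distr Q borel (\<lambda>\<omega>. \<omega> (Inl i)) = U01" for i
    using good_coord[OF good1, of "Inl i" i] by simp
  have law_Y: "distr Q borel (\<lambda>\<omega>. \<omega> (Inr (i, j))) = nu" if "adj i j" for i j
    using good_coord[OF good1, of "Inr (i, j)" i] that adj_irrefl[of i] by auto
  have AE_coord_U: "AE \<omega> in Q. \<omega> (Inl i) \<in> {0..1}" for i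
    using AE_distrD[OF coord[OF in_idx(1)], of "\<lambda>x. x \<in> {0..1}"] AE_U01 unfolding law_U by blast
  have AE_coord_Y: "AE \<omega> in Q. \<omega> (Inr (i, j)) \<in> coded_I" if "adj i j" for i j
    using AE_distrD[OF coord[OF in_idx(2)[THEN iffD2, OF that]], of "\<lambda>x. x \<in> coded_I"] AE_nu
    unfolding law_Y[OF that] by blast
  have indep_free: "Q.indep_vars (\<lambda>_. borel) (\<lambda>e \<omega>. \<omega> e) (free_idx S)" if "finite S" "connected_set adj S" for S
  proof (cases "S = {}")
    \<comment> \<open>Goodness is available for nonempty sets; the empty family is a subfamily of
      the one at an arbitrary site.\<close>
    case True
    have "free_idx {} = {}" by (auto simp: free_idx_def out_arcs_def)
    then show ?thesis
      using Q.indep_vars_subset[OF good_indep_vars[OF good1[of undefined]], of "{}"] True by auto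
  next
    case False
    then show ?thesis using good_indep_vars good that by blast
  qed

  have "P.indep_vars (\<lambda>_. borel) U_var UNIV"
    unfolding P_def
  proof (rule Q.indep_vars_distr[OF E])
    \<comment> \<open>Independence of the infinite family is a condition on finite subfamilies, and
      each of these lies in a finite connected set.\<close>
    have "Q.indep_vars (\<lambda>_. borel) (\<lambda>i \<omega>. clamp01 (\<omega> (Inl i))) J" if J: "finite J" for J
    proof -
      obtain S where S: "finite S" "connected_set adj S" "J \<subseteq> S"
        using finite_connected_superset[OF J] by blast
      have "Inl ` J \<subseteq> free_idx S" using S(3) by auto
      then have "Q.indep_vars (\<lambda>_. borel) (\<lambda>i \<omega>. \<omega> (Inl i)) J"
        using Q.indep_vars_reindex[OF indep_free[OF S(1,2)], of Inl J] by simp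
      then show ?thesis by (rule Q.indep_vars_compose2) simp
    qed
    then have "Q.indep_vars (\<lambda>_. borel) (\<lambda>i \<omega>. clamp01 (\<omega> (Inl i))) UNIV"
      unfolding Q.indep_vars_def2 Q.indep_sets_finite_index_sets[of _ UNIV]
      using measurable_compose[OF coord[OF in_idx(1)] clamp01_measurable] by blast
    then show "Q.indep_vars (\<lambda>_. borel) (\<lambda>i \<omega>. U_var i (to_config \<omega>)) UNIV" by simp
  qed (rule U_var_measurable)

  moreover have "distr P borel (U_var i) = U01" for i
  proof -
    have "distr P borel (U_var i) = distr Q borel (\<lambda>\<omega>. clamp01 (\<omega> (Inl i)))"
      unfolding P_def by (subst distr_distr[OF U_var_measurable E]) (simp add: comp_def)
    also have "\<dots> = distr Q borel (\<lambda>\<omega>. \<omega> (Inl i))"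
    proof (rule distr_cong_AE)
      show "AE \<omega> in Q. clamp01 (\<omega> (Inl i)) = \<omega> (Inl i)"
        using AE_coord_U[of i] by (rule eventually_mono) (rule clamp01_id)
    qed (use coord[of "Inl i"] in auto)
    finally show ?thesis by (simp add: law_U)
  qed

  moreover have "automorphism_invariant adj P"
    unfolding automorphism_invariant_def
  proof (intro allI impI)
    fix \<phi> assume \<phi>: "automorphism adj \<phi>"
    have R: "relabel_coords \<phi> \<in> measurable Q (real_PiM idx)"
      using relabel_coords_measurable[OF \<phi>] Q(2) by (simp cong: measurable_cong_sets)
    have "distr P (config_space adj) (relabel adj \<phi>) = distr Q (config_space adj) (\<lambda>\<omega>. to_config (relabel_coords \<phi> \<omega>))"
      unfolding P_def by (subst distr_distr[OF relabel_measurable[OF \<phi>] E]) (simp add: comp_def relabel_to_config[OF \<phi>])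
    also have "\<dots> = distr (distr Q (real_PiM idx) (relabel_coords \<phi>)) (config_space adj) to_config"
      by (subst distr_distr[OF to_config_measurable R]) (simp add: comp_def)
    also have "\<dots> = P"
      unfolding P_def using good_everywhere_invariant[OF good \<phi>] by simp
    finally show "distr P (config_space adj) (relabel adj \<phi>) = P" .
  qed

  moreover have "has_distribution_function P (Y_var j i) F_dist" if "j \<in> nbrs adj i" for i j
    unfolding has_distribution_function_def
  proof (intro conjI allI)
    have ji: "adj j i" using that by (auto simp: nbrs_def adj_sym)
    show Y: "Y_var j i \<in> borel_measurable P" using Y_P[OF ji] .
    fix t
    have [measurable]: "Y_var j i \<in> borel_measurable (config_space adj)" using Y_var_measurable[OF ji] .
    have "measure P {\<omega> \<in> space P. Y_var j i \<omega> \<le> t} = measure Q (to_config -` {\<omega> \<in> space (config_space adj). Y_var j i \<omega> \<le> t} \<inter> space Q)"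
      unfolding P_def by (subst measure_distr[OF E]) (auto simp: space_distr)
    also have "to_config -` {\<omega> \<in> space (config_space adj). Y_var j i \<omega> \<le> t} \<inter> space Q
        = (\<lambda>\<omega>. \<omega> (Inr (j, i))) -` {x. decode x \<le> t} \<inter> space Q"
      using measurable_space[OF E] ji by auto
    also have "measure Q \<dots> = measure nu {x. decode x \<le> t}"
      unfolding law_Y[OF ji, symmetric] using coord[of "Inr (j, i)"] ji by (subst measure_distr) auto
    finally show "measure P {\<omega> \<in> space P. Y_var j i \<omega> \<le> t} = F_dist t"
      by (simp add: measure_nu_decode_le)
  qed

  moreover have "AE \<omega> in P. Y_var j i \<omega> =
             Phi (min (Y_var i k \<omega>) (Y_var i l \<omega>)) (max (Y_var i k \<omega>) (Y_var i l \<omega>)) (U_var i \<omega>)"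
    if "j \<in> nbrs adj i" and kl: "{k, l} = nbrs adj i - {j}" for i j k l
  proof -
    have adj: "adj i j" "adj j i" "adj i k" "adj i l" using that by (auto simp: nbrs_def adj_sym)
    have [measurable]: "Y_var j i \<in> borel_measurable (config_space adj)" "Y_var i k \<in> borel_measurable (config_space adj)"
      "Y_var i l \<in> borel_measurable (config_space adj)" "U_var i \<in> borel_measurable (config_space adj)"
      using adj by (auto intro: Y_var_measurable U_var_measurable)
    \<comment> \<open>The smallest connected set for which the arc \<open>(j, i)\<close> is
      inner.\<close>
    have "connected_set adj {j, i}" using connected_insert[OF connected_singleton] adj by blast
    then have "AE \<omega> in Q. recursive_on {j, i} \<omega>" by (intro goodD(4) good) auto
    then have "AE \<omega> in Q. \<omega> (Inr (j, i)) = phi (\<omega> (Inr (i, k))) (\<omega> (Inr (i, l))) (\<omega> (Inl i))"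
      by (rule eventually_mono) (use adj message_eq[OF kl[symmetric]] in \<open>auto simp: recursive_on_def\<close>)
    then have "AE \<omega> in Q. Y_var j i (to_config \<omega>) =
        Phi (min (Y_var i k (to_config \<omega>)) (Y_var i l (to_config \<omega>)))
          (max (Y_var i k (to_config \<omega>)) (Y_var i l (to_config \<omega>))) (U_var i (to_config \<omega>))"
      using AE_coord_U[of i] AE_coord_Y[OF adj(3)] AE_coord_Y[OF adj(4)]
      by eventually_elim (simp add: adj clamp01_id decode_phi)
    then show ?thesis
      unfolding P_def by (subst AE_distr_iff[OF E]) (measurable, unfold Phi_def, measurable)
  qed

  moreover have "P.indep_vars (\<lambda>_. borel) (\<lambda>(i, j). Y_var i j) (out_arcs adj S) \<and>
       indep_pair P
         (\<Pi>\<^sub>M e\<in>out_arcs adj S. borel) (\<lambda>\<omega>. \<lambda>(i, j)\<in>out_arcs adj S. Y_var i j \<omega>)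
         (\<Pi>\<^sub>M i\<in>S. borel) (\<lambda>\<omega>. \<lambda>i\<in>S. U_var i \<omega>)"
    if S: "finite S" "connected_set adj S" for S
  proof
    let ?O = "out_arcs adj S"
    let ?Y = "\<lambda>\<omega>. \<lambda>(i, j)\<in>?O. Y_var i j \<omega>" and ?U = "\<lambda>\<omega>. \<lambda>i\<in>S. U_var i \<omega>"
    have O: "adj i j" if "(i, j) \<in> ?O" for i j using that by (auto simp: out_arcs_def nbrs_def)
    have Y_e: "(case e of (i, j) \<Rightarrow> Y_var i j (to_config \<omega>)) = decode (\<omega> (Inr e))" if "e \<in> ?O" for e \<omega>
      using that O by (cases e) auto
    note ind = indep_free[OF S]
    have "Inr ` ?O \<subseteq> free_idx S" by (simp add: free_idx_def)
    then have "Q.indep_vars (\<lambda>_. borel) (\<lambda>e \<omega>. \<omega> (Inr e)) ?O"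
      using Q.indep_vars_reindex[OF ind, of Inr ?O] by simp
    then have dec: "Q.indep_vars (\<lambda>_. borel) (\<lambda>e \<omega>. decode (\<omega> (Inr e))) ?O"
      by (rule Q.indep_vars_compose2) simp
    show "P.indep_vars (\<lambda>_. borel) (\<lambda>(i, j). Y_var i j) ?O"
      unfolding P_def
    proof (rule Q.indep_vars_distr[OF E])
      show "(case e of (i, j) \<Rightarrow> Y_var i j) \<in> borel_measurable (config_space adj)" if "e \<in> ?O" for e
        using that O Y_var_measurable by (cases e) auto
      show "Q.indep_vars (\<lambda>_. borel) (\<lambda>e \<omega>. (case e of (i, j) \<Rightarrow> Y_var i j) (to_config \<omega>)) ?O"
        using dec by (rule Q.indep_vars_cong[THEN iffD1, rotated -1]) (auto simp: O)
    qed
    have Y_m: "?Y \<in> measurable (config_space adj) (\<Pi>\<^sub>M e\<in>?O. borel)"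
      by (intro measurable_restrict) (use O Y_var_measurable in auto)
    have U_m: "?U \<in> measurable (config_space adj) (\<Pi>\<^sub>M i\<in>S. borel)"
      by (intro measurable_restrict U_var_measurable)
    \<comment> \<open>Out-arc values and uniform variables factor through disjoint blocks of the
      independent coordinates.\<close>
    define hY where "hY g = (\<lambda>e\<in>?O. decode (g (Inr e)))" for g :: "'v + 'v \<times> 'v \<Rightarrow> real"
    define hU where "hU g = (\<lambda>i\<in>S. clamp01 (g (Inl i)))" for g :: "'v + 'v \<times> 'v \<Rightarrow> real"
    have hY: "hY \<in> measurable (real_PiM (Inr ` ?O)) (\<Pi>\<^sub>M e\<in>?O. borel)"
      unfolding hY_def[abs_def] by (intro measurable_restrict) auto
    have hU: "hU \<in> measurable (real_PiM (Inl ` S)) (\<Pi>\<^sub>M i\<in>S. borel)"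
      unfolding hU_def[abs_def] by (intro measurable_restrict) auto
    let ?rY = "\<lambda>\<omega>. restrict \<omega> (Inr ` ?O)" and ?rU = "\<lambda>\<omega>. restrict \<omega> (Inl ` S)"
    have Y_fac: "?Y (to_config \<omega>) = hY (?rY \<omega>)" for \<omega>
      unfolding hY_def by (intro restrict_ext) (auto simp: O)
    have U_fac: "?U (to_config \<omega>) = hU (?rU \<omega>)" for \<omega>
      unfolding hU_def by (intro restrict_ext) auto
    have iv: "Q.indep_var (real_PiM (Inr ` ?O)) ?rY (real_PiM (Inl ` S)) ?rU"
      by (rule Q.indep_var_restrict[OF ind]) (auto simp: free_idx_def)
    show "indep_pair P (\<Pi>\<^sub>M e\<in>?O. borel) ?Y (\<Pi>\<^sub>M i\<in>S. borel) ?U"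
      unfolding indep_pair_def
    proof (intro conjI P.indep_setI)
      show "?Y \<in> measurable P (\<Pi>\<^sub>M e\<in>?O. borel)" "?U \<in> measurable P (\<Pi>\<^sub>M i\<in>S. borel)"
        using Y_m U_m by (simp_all add: P_def)
      then show "{?Y -` C \<inter> space P |C. C \<in> sets (\<Pi>\<^sub>M e\<in>?O. borel)} \<subseteq> P.events"
        "{?U -` D \<inter> space P |D. D \<in> sets (\<Pi>\<^sub>M i\<in>S. borel)} \<subseteq> P.events"
        by (auto intro: measurable_sets)
      fix A B assume "A \<in> {?Y -` C \<inter> space P |C. C \<in> sets (\<Pi>\<^sub>M e\<in>?O. borel)}"
        and "B \<in> {?U -` D \<inter> space P |D. D \<in> sets (\<Pi>\<^sub>M i\<in>S. borel)}"
      then obtain C D where C: "C \<in> sets (\<Pi>\<^sub>M e\<in>?O. borel)" "A = ?Y -` C \<inter> space (config_space adj)"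
        and D: "D \<in> sets (\<Pi>\<^sub>M i\<in>S. borel)" "B = ?U -` D \<inter> space (config_space adj)"
        by (auto simp: P_def)
      let ?C = "hY -` C \<inter> space (real_PiM (Inr ` ?O))" and ?D = "hU -` D \<inter> space (real_PiM (Inl ` S))"
      have CD: "?C \<in> sets (real_PiM (Inr ` ?O))" "?D \<in> sets (real_PiM (Inl ` S))"
        using hY hU C D by (auto intro: measurable_sets)
      have AB: "A \<in> sets (config_space adj)" "B \<in> sets (config_space adj)"
        using Y_m U_m C D by (auto intro: measurable_sets)
      have A': "to_config -` A \<inter> space Q = ?rY -` ?C \<inter> space Q"
        unfolding set_eq_iff C(2) vimage_eq Int_iff Y_fac using measurable_space[OF E] by (auto simp: space_PiM)
      have B': "to_config -` B \<inter> space Q = ?rU -` ?D \<inter> space Q"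
        unfolding set_eq_iff D(2) vimage_eq Int_iff U_fac using measurable_space[OF E] by (auto simp: space_PiM)
      have AB': "to_config -` (A \<inter> B) \<inter> space Q = (\<lambda>\<omega>. (?rY \<omega>, ?rU \<omega>)) -` (?C \<times> ?D) \<inter> space Q"
        using A' B' by blast
      show "P.prob (A \<inter> B) = P.prob A * P.prob B"
        unfolding P_def measure_distr[OF E AB(1)] measure_distr[OF E AB(2)]
          measure_distr[OF E sets.Int[OF AB]] A' B' AB'
        by (rule Q.indep_varD[OF iv CD])
    qed
  qed

  ultimately show ?thesis
    using P.prob_space_axioms sets_P
    by (intro exI[of _ P] conjI allI ballI impI; (elim conjE)?) simp_all
qed

end
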